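(* Let $X$ be an infinite h-homogeneous zero-dimensional compact Hausdorff space, $G=\mathrm{Homeo}(X)$ with the compact-open topology, and $k\ge1$. Then every minimal subsystem $\Sigma\subset\Omega_k$ is a factor of $\Phi(X)$, i.e. there is a continuous $G$-equivariant surjection $\Phi(X)\to\Sigma$.
   Context: h-homogeneous: every nonempty clopen subset of $X$ is homeomorphic to $X$. $\Phi(X)\subset\mathrm{Exp}(\mathrm{Exp}(X))$ is the compact space of maximal chains of nonempty closed subsets of $X$ (maximal families totally ordered by inclusion, Vietoris topologies), with $gc=\{gF:F\in c\}$. $\mathcal D_k$ is the set of ordered partitions $(B_1,\dots,B_k)$ of $X$ into $k$ nonempty clopen sets, on which $G$ acts piecewise. $\Omega_k=\{1,-1\}^{\mathcal D_k}$ with the product topology and $G$-action $(g\omega)(\beta)=\omega(g^{-1}\beta)$. A minimal subsystem is a nonempty closed $G$-invariant subset containing no smaller such subset. *)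

theory Defs
  imports "HOL-Analysis.Analysis"
begin

definition h_homogeneous :: "'a topology \<Rightarrow> bool" where
  "h_homogeneous X \<longleftrightarrow>
     (\<forall>C. openin X C \<and> closedin X C \<and> C \<noteq> {} \<longrightarrow> subtopology X C homeomorphic_space X)"

text \<open>The homeomorphism group Homeo(X) (as a set of maps; only values on topspace matter).\<close>
definition homeo :: "'a topology \<Rightarrow> ('a \<Rightarrow> 'a) set" where
  "homeo X = {g. homeomorphic_map X X g}"

definition hyp :: "'a topology \<Rightarrow> 'a set set" where
  "hyp X = {F. closedin X F \<and> F \<noteq> {}}"

definition vietoris :: "'a topology \<Rightarrow> 'a set topology" where
  "vietoris X = topology_generated_by
     ({{F \<in> hyp X. F \<subseteq> U} | U. openin X U} \<union> {{F \<in> hyp X. F \<inter> U \<noteq> {}} | U. openin X U})"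

definition Phi_space :: "'a topology \<Rightarrow> 'a set set topology" where
  "Phi_space X = subtopology (vietoris (vietoris X)) {c. subset.maxchain (hyp X) c}"

definition act_Phi :: "('a \<Rightarrow> 'a) \<Rightarrow> 'a set set \<Rightarrow> 'a set set" where
  "act_Phi g c = (\<lambda>F. g ` F) ` c"

definition Dk :: "'a topology \<Rightarrow> nat \<Rightarrow> 'a set list set" where
  "Dk X k = {\<beta>. length \<beta> = k \<and>
      (\<forall>B\<in>set \<beta>. openin X B \<and> closedin X B \<and> B \<noteq> {}) \<and>
      (\<forall>i<k. \<forall>j<k. i \<noteq> j \<longrightarrow> \<beta> ! i \<inter> \<beta> ! j = {}) \<and>
      \<Union>(set \<beta>) = topspace X}"

definition Omega :: "'a topology \<Rightarrow> nat \<Rightarrow> ('a set list \<Rightarrow> int) topology" where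
  "Omega X k = product_topology (\<lambda>_. discrete_topology {1, -1}) (Dk X k)"

definition act_Omega :: "'a topology \<Rightarrow> nat \<Rightarrow> ('a \<Rightarrow> 'a) \<Rightarrow> ('a set list \<Rightarrow> int) \<Rightarrow> ('a set list \<Rightarrow> int)" where
  "act_Omega X k g \<omega> = restrict (\<lambda>\<beta>. \<omega> (map (\<lambda>B. inv_into (topspace X) g ` B) \<beta>)) (Dk X k)"

definition invariant_set :: "('g \<Rightarrow> 'b \<Rightarrow> 'b) \<Rightarrow> 'g set \<Rightarrow> 'b set \<Rightarrow> bool" where
  "invariant_set act G S \<longleftrightarrow> (\<forall>g\<in>G. \<forall>x\<in>S. act g x \<in> S)"

definition minimal_subsystem :: "'b topology \<Rightarrow> ('g \<Rightarrow> 'b \<Rightarrow> 'b) \<Rightarrow> 'g set \<Rightarrow> 'b set \<Rightarrow> bool" where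
  "minimal_subsystem T act G S \<longleftrightarrow>
     S \<noteq> {} \<and> closedin T S \<and> invariant_set act G S \<and>
     (\<forall>S'. S' \<noteq> {} \<and> closedin T S' \<and> invariant_set act G S' \<and> S' \<subseteq> S \<longrightarrow> S' = S)"

end

(*
  A maximal chain c of closed sets orders the clopen sets by the moment at which the members of c,
  taken from small to large, first hit them; disjoint clopen sets are hit at different moments, so c
  induces a linear order on the blocks of every clopen partition. Conversely, every coherent order on
  the clopen sets comes from a maximal chain. Call a point of Omega_k a pattern if its value at an
  ordered partition depends only, through a fixed function phi, on the order type that some maximal
  chain induces on this partition.

  The dual Ramsey theorem of Graham and Rothschild provides, for every omega and every m, an ordered
  partition into m blocks such that omega, restricted to the coarsenings of this partition, depends
  only on the order type of the coarsening. As X is h-homogeneous, Homeo(X) acts transitively on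
  the ordered partitions with m blocks. So, for a phi that serves infinitely many m, all patterns with
  function phi lie in the orbit closure of omega. For omega in a minimal subsystem Sigma, the set of
  these patterns is closed, by compactness of the space of orders, and invariant, hence equal to
  Sigma. Sending a chain to its pattern is the required factor map.
*)
theory Submission
  imports Defs
begin

text \<open>A union of pieces is hit by a chain when the first of its pieces is. So, if the pieces
  of a fine partition are listed in the order in which the chain hits them, the order type of a
  coarsening is the order of first occurrences of letters in the word that describes it. This is
  what ties chains to parameter words.

  Graham-Rothschild colours partitions whose blocks carry the canonical numbering, while omega sees
  every numbering. A word is therefore coloured by the whole vector of values of omega over its
  renumberings, and phi records one value per order type. Moreover phi has to be fixed before the
  order and the finitely many coordinates to be matched are given. Only finitely many functions phi
  are possible, so one of them is available for arbitrarily fine partitions.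

  The Ramsey theorem is applied with the empty alphabet but proved for every finite one: the
  induction on the number of parameters turns the first parameter of a word into a new
  constant.\<close>

section \<open>Parameter words\<close>

text \<open>A word \<open>w\<close> with \<open>rigid a (a + m) w\<close> is an \<open>m\<close>-parameter word over the alphabet \<open>{0..<a}\<close>:
  letters below \<open>a\<close> are constants, the letter \<open>a + i\<close> is the \<open>i\<close>-th parameter, every parameter occurs,
  and first occurrences come in increasing order. For \<open>a = 0\<close> these words are the partitions of the
  set of positions into \<open>m\<close> blocks, numbered by least elements.\<close>

fun rigid :: "nat \<Rightarrow> nat \<Rightarrow> nat list \<Rightarrow> bool" where
  "rigid a b [] \<longleftrightarrow> a = b"
| "rigid a b (c # w) \<longleftrightarrow> c < a \<and> rigid a b w \<or> c = a \<and> rigid (Suc a) b w"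

definition letter :: "nat \<Rightarrow> nat list \<Rightarrow> nat \<Rightarrow> nat" where
  "letter a u c = (if c < a then c else u ! (c - a))"

text \<open>Substitution of the word \<open>u\<close> for the parameters; \<open>u\<close> must have one entry per parameter.\<close>

abbreviation subst :: "nat \<Rightarrow> nat list \<Rightarrow> nat list \<Rightarrow> nat list" where
  "subst a u \<equiv> map (letter a u)"

abbreviation constant_prefix :: "nat \<Rightarrow> nat list \<Rightarrow> nat list" where
  "constant_prefix a \<equiv> takeWhile (\<lambda>c. c < a)"

lemma rigid_le: "rigid a b w \<Longrightarrow> a \<le> b"
  by (induction w arbitrary: a) (auto dest: Suc_leD)

lemma rigid_set: "rigid a b w \<Longrightarrow> set w \<subseteq> {..<b}"
proof (induction w arbitrary: a)
  case (Cons c w)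
  then show ?case
    using rigid_le[of a b w] rigid_le[of "Suc a" b w] by fastforce
qed simp

lemma rigid_surj: "rigid a b w \<Longrightarrow> {a..<b} \<subseteq> set w"
proof (induction w arbitrary: a)
  case (Cons c w)
  show ?case
  proof
    fix i assume i: "i \<in> {a..<b}"
    from Cons.prems show "i \<in> set (c # w)"
      using Cons.IH[of a] Cons.IH[of "Suc a"] i
      by (cases "i = a") (auto simp: subset_iff)
  qed
qed simp

text \<open>Constant words are the rigid words without parameters; this makes Hales-Jewett the case
  \<open>k = 0\<close> of a single Ramsey statement.\<close>

lemma rigid_const_iff: "rigid a a w \<longleftrightarrow> set w \<subseteq> {..<a}"
proof (induction w)
  case (Cons c w)
  then show ?case using rigid_le[of "Suc a" a w] by auto
qed simp

lemma rigid_append: "rigid a b v \<Longrightarrow> rigid b c w \<Longrightarrow> rigid a c (v @ w)"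
  by (induction v arbitrary: a) auto

lemma rigid_upt: "rigid a (a + m) [a..<a + m]"
proof (induction m)
  case (Suc m)
  then show ?case using rigid_append[of a "a + m" "[a..<a + m]" "Suc (a + m)" "[a + m]"] by simp
qed simp

lemma subst_upt: "length u = m \<Longrightarrow> subst a u [a..<a + m] = u"
  by (intro nth_equalityI) (auto simp: letter_def)

text \<open>Makes room above the constants below \<open>a\<close>. With \<open>i = 1\<close> it
  inserts the new constant \<open>a\<close> into the alphabet; in the induction on \<open>k\<close>
  it turns the constant \<open>a\<close> into the parameter \<open>a + i\<close>.\<close>

lemma rigid_shift:
  "rigid s b w \<Longrightarrow> a \<le> s \<Longrightarrow> rigid (s + i) (b + i) (map (\<lambda>c. if c < a then c else c + i) w)"
proof (induction w arbitrary: s)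
  case (Cons c w)
  then show ?case using Cons.IH[of s] Cons.IH[of "Suc s"] by auto
qed simp

lemma rigid_split:
  "rigid s b w \<Longrightarrow> s \<le> j \<Longrightarrow> j < b \<Longrightarrow> \<exists>v v'. w = v @ j # v' \<and> set v \<subseteq> {..<j}"
proof (induction w arbitrary: s)
  case (Cons c w)
  consider "c < s" "rigid s b w" | "c = s" "s = j" | "c = s" "s < j" "rigid (Suc s) b w"
    using Cons.prems by fastforce
  then show ?case
  proof cases
    case 1
    then obtain v v' where "w = v @ j # v'" "set v \<subseteq> {..<j}"
      using Cons.IH[of s] Cons.prems by auto
    then show ?thesis using 1 Cons.prems by (intro exI[of _ "c # v"] exI[of _ v']) auto
  next
    case 2
    then show ?thesis by (intro exI[of _ "[]"] exI[of _ w]) auto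
  next
    case 3
    then obtain v v' where "w = v @ j # v'" "set v \<subseteq> {..<j}"
      using Cons.IH[of "Suc s"] Cons.prems by auto
    then show ?thesis using 3 Cons.prems by (intro exI[of _ "c # v"] exI[of _ v']) auto
  qed
qed simp

lemma rigidI:
  "\<lbrakk>a \<le> b; set w \<subseteq> {..<b}; {a..<b} \<subseteq> set w;
    \<And>l i. \<lbrakk>l < length w; a \<le> i; i < w ! l\<rbrakk> \<Longrightarrow> \<exists>l'<l. w ! l' = i\<rbrakk> \<Longrightarrow> rigid a b w"
proof (induction w arbitrary: a)
  case (Cons c w)
  have "c \<le> a"
    using Cons.prems(4)[of 0 a] by (rule_tac ccontr) auto
  moreover have *: "\<exists>l'<l. w ! l' = i" if hyp: "l < length w" "a \<le> i" "i < w ! l" "i \<noteq> c" for l i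
  proof -
    have "\<exists>l'<Suc l. (c # w) ! l' = i"
      using Cons.prems(4)[of "Suc l" i] hyp by simp
    then obtain l' where l': "l' < Suc l" "(c # w) ! l' = i" by blast
    then obtain l'' where "l' = Suc l''" using hyp l' by (cases l') auto
    then show ?thesis using l' by auto
  qed
  moreover have "rigid a b w" if "c < a"
    using that Cons.prems by (intro Cons.IH *) (auto simp: subset_iff)
  moreover have "rigid (Suc a) b w" if "c = a"
  proof (rule Cons.IH)
    show "{Suc a..<b} \<subseteq> set w"
    proof
      fix i assume "i \<in> {Suc a..<b}"
      then have "i \<in> set (c # w)" "i \<noteq> c" using subsetD[OF Cons.prems(3), of i] that by auto
      then show "i \<in> set w" by simp
    qed
  qed (use that Cons.prems * in auto)
  ultimately show ?case by (cases "c < a") auto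
qed auto

text \<open>While the prefix of \<open>w\<close> that ends in state \<open>s\<close> is read, exactly the part \<open>u1\<close> of \<open>u\<close> has been used, and
  the image word is in the state \<open>t\<close> reached by \<open>u1\<close>.\<close>

lemma rigid_subst_aux:
  "\<lbrakk>rigid s b w; a \<le> s; u = u1 @ u2; length u1 = s - a; length u = b - a;
    set u1 \<subseteq> {..<t}; a \<le> t; rigid t c u2\<rbrakk> \<Longrightarrow> rigid t c (subst a u w)"
proof (induction w arbitrary: s t u1 u2)
  case (Cons d w)
  consider "d < s" "rigid s b w" | "d = s" "rigid (Suc s) b w"
    using Cons.prems(1) by auto
  then show ?case
  proof cases
    case 1
    have "letter a u d < t"
    proof (cases "d < a")
      case False
      then have "u ! (d - a) \<in> set u1"
        using Cons.prems 1 by (auto simp: nth_append)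
      then show ?thesis using False Cons.prems(6) by (auto simp: letter_def)
    qed (use Cons.prems in \<open>auto simp: letter_def\<close>)
    moreover have "rigid t c (subst a u w)"
      using Cons.IH[OF 1(2) Cons.prems(2-)] .
    ultimately show ?thesis by simp
  next
    case 2
    then have "s < b" using rigid_le by fastforce
    then obtain x u2' where u2: "u2 = x # u2'"
      using Cons.prems by (cases u2) auto
    have x: "letter a u d = x"
      using 2 Cons.prems u2 by (auto simp: letter_def nth_append)
    have IH: "rigid t' c (subst a u w)" if "rigid t' c u2'" "t \<le> t'" "x < t'" for t'
      using 2 Cons.prems that u2
      by (intro Cons.IH[of "Suc s" "u1 @ [x]" u2' t']) auto
    have "x < t \<and> rigid t c u2' \<or> x = t \<and> rigid (Suc t) c u2'"
      using Cons.prems u2 by simp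
    then show ?thesis using IH[of t] IH[of "Suc t"] x by auto
  qed
next
  case Nil
  then have "length u1 + length u2 = length u1" by simp
  then have "u2 = []" by simp
  with Nil(8) Nil show ?case by simp
qed

text \<open>Composition of words: \<open>c = a\<close> plugs in constants, larger \<open>c\<close>
  passes to a word with fewer parameters.\<close>

lemma rigid_subst:
  assumes "rigid a b w" "length u = b - a" "rigid a c u"
  shows "rigid a c (subst a u w)"
  using rigid_subst_aux[OF assms(1), of a u "[]" u a c] assms by simp

lemma set_subst_constant:
  assumes "rigid a (a + m) w" "length u = m" "set u \<subseteq> {..<a}"
  shows "set (subst a u w) \<subseteq> {..<a}"
  using rigid_subst[OF assms(1), of u a] assms(2,3) unfolding rigid_const_iff by simp

text \<open>Associativity of composition: what is known about the instances of \<open>w\<close>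
  passes to the instances of \<open>subst a u w\<close>.\<close>

lemma subst_subst:
  assumes "set w \<subseteq> {..<a + length u}"
  shows "subst a v (subst a u w) = subst a (subst a v u) w"
  using assms by (auto simp: letter_def subset_iff)

lemma subst_append_left:
  assumes "set w \<subseteq> {..<a + length u}"
  shows "subst a (u @ v) w = subst a u w"
  using assms by (auto simp: letter_def nth_append subset_iff)

text \<open>The first nonconstant entry \<open>x\<close> replaces the parameter
  \<open>a + length q\<close>, so the image stops being constant where that parameter first occurs,
  and everything before involves only \<open>q\<close>.\<close>

lemma constant_prefix_subst:
  assumes "rigid a (a + m) w" "length q < m" "set q \<subseteq> {..<a}" "a \<le> x"
  shows "constant_prefix a (subst a (q @ x # v) w)
       = subst a q (takeWhile (\<lambda>c. c < a + length q) w)"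
proof -
  obtain w1 w2 where w: "w = w1 @ (a + length q) # w2" "set w1 \<subseteq> {..<a + length q}"
    using rigid_split[OF assms(1), of "a + length q"] assms(2) by auto
  have "takeWhile (\<lambda>c. c < a + length q) w = w1"
    using w by (auto simp: takeWhile_append2 subset_iff)
  moreover have "subst a (q @ x # v) w1 = subst a q w1"
    using subst_append_left[OF w(2)] .
  moreover have "\<forall>c \<in> set (subst a q w1). c < a"
    using w(2) assms(3) nth_mem by (fastforce simp: letter_def subset_iff)
  moreover have "letter a (q @ x # v) (a + length q) = x"
    by (simp add: letter_def)
  ultimately show ?thesis
    using assms(4) w(1) by (simp add: takeWhile_append2 takeWhile_append)
qed

lemma constant_prefix_decomp:
  assumes "\<not> set u \<subseteq> {..<a}"
  obtains x v where "u = constant_prefix a u @ x # v" "a \<le> x"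
proof -
  have "dropWhile (\<lambda>c. c < a) u \<noteq> []" using assms by auto
  then obtain x v where "dropWhile (\<lambda>c. c < a) u = x # v" by (meson list.exhaust)
  moreover from this have "a \<le> x" using hd_dropWhile[of "\<lambda>c. c < a" u] by auto
  ultimately show ?thesis using that takeWhile_dropWhile_id by metis
qed

lemma set_constant_prefix: "set (constant_prefix a u) \<subseteq> {..<a}"
  using set_takeWhileD by fastforce

lemma not_constant_subst:
  assumes "rigid a (a + m) w" "length u = m" "\<not> set u \<subseteq> {..<a}"
  shows "\<not> set (subst a u w) \<subseteq> {..<a}"
proof -
  obtain i where i: "i < m" "a \<le> u ! i"
    using assms(2,3) by (metis in_set_conv_nth lessThan_iff not_le subsetI)
  then have "a + i \<in> set w" using rigid_surj[OF assms(1)] by auto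
  then have "letter a u (a + i) \<in> set (subst a u w)" by simp
  moreover have "letter a u (a + i) = u ! i" by (simp add: letter_def)
  ultimately show ?thesis using i by (metis lessThan_iff not_le subsetD)
qed

text \<open>A family of colourings indexed by the finite set \<open>P\<close> becomes one colouring
  by numbers, so one application of a Ramsey statement treats all of them simultaneously.\<close>

lemma encode_vectors:
  fixes F :: "'x \<Rightarrow> 'p \<Rightarrow> 'c"
  assumes "finite P" "finite C" "\<And>x p. F x p \<in> C"
  obtains e :: "'x \<Rightarrow> nat" where
    "\<And>x. e x < card C ^ card P" "\<And>x y p. \<lbrakk>e x = e y; p \<in> P\<rbrakk> \<Longrightarrow> F x p = F y p"
proof -
  have fin: "finite (PiE P (\<lambda>_. C))" using assms by (simp add: finite_PiE)
  obtain h where h: "bij_betw h (PiE P (\<lambda>_. C)) {0..<card (PiE P (\<lambda>_. C))}"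
    using ex_bij_betw_finite_nat[OF fin] by blast
  define e where "e x = h (restrict (F x) P)" for x
  have mem: "restrict (F x) P \<in> PiE P (\<lambda>_. C)" for x using assms by auto
  show ?thesis
  proof
    fix x show "e x < card C ^ card P"
      using bij_betwE[OF h] mem[of x] assms(1) by (auto simp: e_def card_PiE)
  next
    fix x y p assume "e x = e y" "p \<in> P"
    then have "restrict (F x) P = restrict (F y) P"
      using bij_betw_imp_inj_on[OF h] mem unfolding e_def by (meson inj_onD)
    then show "F x p = F y p" using \<open>p \<in> P\<close> by (metis restrict_apply')
  qed
qed

section \<open>The Hales-Jewett and Graham-Rothschild theorems\<close>

text \<open>Shelah's construction: among the words \<open>0\<dots>0a\<dots>a\<close> two must induce the same colouring of all
  contexts, and filling the positions in which they differ with a parameter gives a block in which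
  the letters \<open>0\<close> and \<open>a\<close> cannot be distinguished.\<close>

lemma letter_collapsing_word:
  assumes "a \<ge> 1"
  shows "\<exists>n. \<forall>\<kappa> :: nat list \<Rightarrow> nat. (\<forall>u. \<kappa> u < r) \<longrightarrow>
    (\<exists>w. length w = n \<and> rigid (Suc a) (Suc a + m) w \<and>
      (\<forall>q. length q = m \<and> set q \<subseteq> {..<Suc a} \<longrightarrow>
        \<kappa> (subst (Suc a) q w) = \<kappa> (subst (Suc a) (map (\<lambda>c. if c = a then 0 else c) q) w)))"
proof (induction m arbitrary: r)
  case 0
  show ?case by (intro exI[of _ 0]) auto
next
  case (Suc m)
  let ?z = "\<lambda>c::nat. if c = a then 0 else c"
  \<comment> \<open>The exponent \<open>Suc a\<close> is the number of letters: a prefix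
    \<open>p\<close> will be coloured by the vector of colours of \<open>p @ h c\<close> for all
    letters \<open>c\<close>.\<close>
  obtain n where n: "\<And>\<kappa> :: nat list \<Rightarrow> nat. (\<And>u. \<kappa> u < r ^ Suc a) \<Longrightarrow>
    \<exists>w. length w = n \<and> rigid (Suc a) (Suc a + m) w \<and>
      (\<forall>q. length q = m \<and> set q \<subseteq> {..<Suc a} \<longrightarrow>
        \<kappa> (subst (Suc a) q w) = \<kappa> (subst (Suc a) (map ?z q) w))"
    using Suc.IH[of "r ^ Suc a"] by blast
  define P where "P = {p. set p \<subseteq> {..<Suc a} \<and> length p = n}"
  have P: "finite P" "card P = Suc a ^ n"
    unfolding P_def using finite_lists_length_eq[of "{..<Suc a}" n] card_lists_length_eq[of "{..<Suc a}" n]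
    by simp_all
  \<comment> \<open>The number of colour vectors on the contexts \<open>P\<close>. There are
    \<open>n' + 1\<close> words \<open>z s\<close>, so two of them have the same vector.\<close>
  define n' where "n' = r ^ (Suc a ^ n)"
  show ?case
  proof (intro exI[of _ "n + n'"] allI impI)
    fix \<kappa> :: "nat list \<Rightarrow> nat" assume \<kappa>: "\<forall>u. \<kappa> u < r"
    define z where "z s = replicate s 0 @ replicate (n' - s) a" for s
    obtain e :: "nat \<Rightarrow> nat" where e: "\<And>s. e s < n'"
      "\<And>s s' p. \<lbrakk>e s = e s'; p \<in> P\<rbrakk> \<Longrightarrow> \<kappa> (p @ z s) = \<kappa> (p @ z s')"
      using encode_vectors[of P "{..<r}" "\<lambda>s p. \<kappa> (p @ z s)"] P \<kappa>
      by (auto simp: n'_def)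
    have "\<not> inj_on e {..n'}"
      using card_inj_on_le[of e "{..n'}" "{..<n'}"] e(1) by auto
    then obtain i j where ij: "i \<le> n'" "j \<le> n'" "e i = e j" "i \<noteq> j"
      by (auto simp: inj_on_def)
    obtain s s' where s: "s < s'" "s' \<le> n'" "e s = e s'"
      using ij by (metis linorder_neqE_nat)
    define h where "h x = replicate s 0 @ replicate (s' - s) x @ replicate (n' - s') a" for x
    have h0: "h 0 = z s'" and ha: "h a = z s"
      using s replicate_add[of s "s' - s" "0::nat"] replicate_add[of "s' - s" "n' - s'" a]
      by (simp_all add: h_def z_def)
    obtain \<kappa>' :: "nat list \<Rightarrow> nat" where \<kappa>': "\<And>p. \<kappa>' p < r ^ Suc a"
      "\<And>p p' c. \<lbrakk>\<kappa>' p = \<kappa>' p'; c < Suc a\<rbrakk> \<Longrightarrow> \<kappa> (p @ h c) = \<kappa> (p' @ h c)"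
      using encode_vectors[of "{..<Suc a}" "{..<r}" "\<lambda>p c. \<kappa> (p @ h c)"] \<kappa> by auto
    obtain w where w: "length w = n" "rigid (Suc a) (Suc a + m) w"
      "\<And>q. length q = m \<Longrightarrow> set q \<subseteq> {..<Suc a} \<Longrightarrow>
        \<kappa>' (subst (Suc a) q w) = \<kappa>' (subst (Suc a) (map ?z q) w)"
      using n[of \<kappa>', OF \<kappa>'(1)] by blast
    let ?W = "w @ h (Suc a + m)"
    have "rigid (Suc a + m) (Suc a + Suc m) (h (Suc a + m))"
    proof -
      have "s' - s = Suc (s' - s - 1)" using s by simp
      then have "replicate (s' - s) (Suc a + m) = [Suc a + m] @ replicate (s' - s - 1) (Suc a + m)"
        by (metis append_Cons append_Nil replicate_Suc)
      moreover have "rigid (Suc a + m) (Suc a + m) (replicate s 0)"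
        by (auto simp: rigid_const_iff)
      moreover have "rigid (Suc a + m) (Suc a + Suc m) [Suc a + m]" by simp
      moreover have "rigid (Suc a + Suc m) (Suc a + Suc m) (replicate (s' - s - 1) (Suc a + m))"
        by (auto simp: rigid_const_iff)
      moreover have "rigid (Suc a + Suc m) (Suc a + Suc m) (replicate (n' - s') a)"
        by (auto simp: rigid_const_iff)
      ultimately show ?thesis unfolding h_def by (metis rigid_append)
    qed
    then have W: "rigid (Suc a) (Suc a + Suc m) ?W" using w(2) rigid_append by blast
    have "length ?W = n + n'" using s w by (simp add: h_def)
    moreover have "\<kappa> (subst (Suc a) q ?W) = \<kappa> (subst (Suc a) (map ?z q) ?W)"
      if q: "length q = Suc m" "set q \<subseteq> {..<Suc a}" for q
    proof -
      obtain q' c where qc: "q = q' @ [c]" "length q' = m" "set q' \<subseteq> {..<Suc a}" "c < Suc a"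
        using q by (cases q rule: rev_cases) auto
      have W_eq: "subst (Suc a) (v @ [d]) ?W = subst (Suc a) v w @ h d"
        if "length v = m" for v d
        using subst_append_left[of w "Suc a" v "[d]"] rigid_set[OF w(2)] that assms
        by (simp add: h_def letter_def nth_append)
      have inP: "subst (Suc a) (map ?z q') w \<in> P"
        unfolding P_def using set_subst_constant[OF w(2), of "map ?z q'"] qc(2,3) w(1) by auto
      have "\<kappa> (subst (Suc a) q ?W) = \<kappa> (subst (Suc a) q' w @ h c)"
        unfolding qc(1) W_eq[OF qc(2)] ..
      also have "\<dots> = \<kappa> (subst (Suc a) (map ?z q') w @ h c)"
        using w(3)[OF qc(2,3)] \<kappa>'(2) qc(4) by blast
      \<comment> \<open>The last letter changes only if it is \<open>a\<close>; then
        \<open>h a = z s\<close> is traded for \<open>h 0 = z s'\<close>, and no context in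
        \<open>P\<close> tells these apart.\<close>
      also have "\<dots> = \<kappa> (subst (Suc a) (map ?z q') w @ h (?z c))"
        using e(2)[OF s(3) inP] h0 ha by auto
      also have "\<dots> = \<kappa> (subst (Suc a) (map ?z q' @ [?z c]) ?W)"
        unfolding W_eq[OF trans[OF length_map qc(2)]] ..
      also have "map ?z q' @ [?z c] = map ?z q" using qc(1) by simp
      finally show ?thesis .
    qed
    ultimately show "\<exists>w. length w = n + n' \<and> rigid (Suc a) (Suc a + Suc m) w \<and>
      (\<forall>q. length q = Suc m \<and> set q \<subseteq> {..<Suc a} \<longrightarrow>
        \<kappa> (subst (Suc a) q w) = \<kappa> (subst (Suc a) (map ?z q) w))"
      using W by (intro exI[of _ ?W]) blast
  qed
qed

text \<open>The Graham-Rothschild property of the length \<open>n\<close>: \<open>k\<close> is the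
  dimension of the coloured words, \<open>m\<close> that of the homogeneous word, and
  \<open>r\<close> bounds the number of colours.\<close>

definition ramsey :: "nat \<Rightarrow> nat \<Rightarrow> nat \<Rightarrow> nat \<Rightarrow> nat \<Rightarrow> bool" where
  "ramsey k a m r n \<longleftrightarrow> (\<forall>\<kappa> :: nat list \<Rightarrow> nat. (\<forall>u. \<kappa> u < r) \<longrightarrow>
    (\<exists>w col. length w = n \<and> rigid a (a + m) w \<and>
      (\<forall>u. length u = m \<and> rigid a (a + k) u \<longrightarrow> \<kappa> (subst a u w) = col)))"

lemma ramseyD:
  assumes "ramsey k a m r n" "\<And>u. \<kappa> u < r"
  obtains w col where "length w = n" "rigid a (a + m) w"
    "\<And>u. \<lbrakk>length u = m; rigid a (a + k) u\<rbrakk> \<Longrightarrow> \<kappa> (subst a u w) = col"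
  using assms unfolding ramsey_def by blast

text \<open>Induction on the alphabet: along a word that cannot distinguish \<open>a\<close> from 0,
  a colouring over \<open>a + 1\<close> letters behaves like one over \<open>a\<close> letters. That
  word therefore needs as many parameters as the length \<open>n1\<close> for \<open>a\<close>
  letters.\<close>

lemma hales_jewett: "\<exists>n. ramsey 0 a m r n"
proof (induction a arbitrary: m r)
  \<comment> \<open>Over at most one letter there is at most one constant word of each length, so
    the word consisting of the bare parameters works.\<close>
  have triv: "ramsey 0 a m r m" if "a \<le> 1" for a m r
  proof -
    have "u = replicate m 0" if "length u = m" "rigid a a u" for u
      using that \<open>a \<le> 1\<close> by (auto simp: rigid_const_iff subset_iff intro!: replicate_eqI)
    then have *: "\<kappa> (subst a u [a..<a + m]) = \<kappa> (replicate m 0)"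
      if "length u = m \<and> rigid a (a + 0) u" for u and \<kappa> :: "nat list \<Rightarrow> nat"
      using that by (metis add_0_right subst_upt)
    show ?thesis
      unfolding ramsey_def using * rigid_upt[of a m] length_upt[of a "a + m"]
      by (metis diff_add_inverse)
  qed
  case 0
  show ?case using triv by blast
  case (Suc a)
  show ?case
  proof (cases "a = 0")
    case True
    then show ?thesis using triv[of "Suc a"] by auto
  next
    case False
    obtain n1 where n1: "ramsey 0 a m r n1" using Suc.IH by blast
    obtain n where n: "\<And>\<kappa> :: nat list \<Rightarrow> nat. (\<And>u. \<kappa> u < r) \<Longrightarrow>
      \<exists>w. length w = n \<and> rigid (Suc a) (Suc a + n1) w \<and>
        (\<forall>q. length q = n1 \<and> set q \<subseteq> {..<Suc a} \<longrightarrow>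
          \<kappa> (subst (Suc a) q w) = \<kappa> (subst (Suc a) (map (\<lambda>c. if c = a then 0 else c) q) w))"
      using letter_collapsing_word[of a r n1] False by auto
    have "ramsey 0 (Suc a) m r n"
      unfolding ramsey_def
    proof (intro allI impI)
      fix \<kappa> :: "nat list \<Rightarrow> nat" assume \<kappa>: "\<forall>u. \<kappa> u < r"
      let ?z = "\<lambda>c::nat. if c = a then 0 else c"
      obtain w where w: "length w = n" "rigid (Suc a) (Suc a + n1) w"
        "\<And>q. \<lbrakk>length q = n1; set q \<subseteq> {..<Suc a}\<rbrakk> \<Longrightarrow>
          \<kappa> (subst (Suc a) q w) = \<kappa> (subst (Suc a) (map ?z q) w)"
        using n[of \<kappa>] \<kappa> by blast
      obtain w' col where w': "length w' = n1" "rigid a (a + m) w'"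
        "\<And>u. \<lbrakk>length u = m; rigid a (a + 0) u\<rbrakk> \<Longrightarrow>
          \<kappa> (subst (Suc a) (subst a u w') w) = col"
        using ramseyD[OF n1, of "\<lambda>q. \<kappa> (subst (Suc a) q w)"] \<kappa> by blast
      define v where "v = map (\<lambda>c. if c < a then c else c + 1) w'"
      have v: "rigid (Suc a) (Suc a + m) v"
        using rigid_shift[OF w'(2), of a 1] by (simp add: v_def)
      have "rigid (Suc a) (Suc a + m) (subst (Suc a) v w)"
        using rigid_subst[OF w(2) _ v] w'(1) by (simp add: v_def)
      moreover have "\<kappa> (subst (Suc a) u (subst (Suc a) v w)) = col"
        if u: "length u = m" "rigid (Suc a) (Suc a + 0) u" for u
      proof -
        have u': "set u \<subseteq> {..<Suc a}" using u by (simp add: rigid_const_iff)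
        have zu: "rigid a (a + 0) (map ?z u)"
          using u' False by (auto simp: rigid_const_iff subset_iff less_Suc_eq)
        have "subst (Suc a) u (subst (Suc a) v w) = subst (Suc a) (subst (Suc a) u v) w"
          using rigid_set[OF w(2)] w'(1) by (intro subst_subst) (simp add: v_def)
        moreover have "\<kappa> (subst (Suc a) (subst (Suc a) u v) w)
            = \<kappa> (subst (Suc a) (map ?z (subst (Suc a) u v)) w)"
        proof (rule w(3))
          show "set (subst (Suc a) u v) \<subseteq> {..<Suc a}"
            using set_subst_constant[OF v u(1) u'] .
        qed (simp add: v_def w')
        \<comment> \<open>The constants of \<open>v\<close> lie below \<open>a\<close>, so
          collapsing changes only letters that were substituted from \<open>u\<close>.\<close>
        moreover have "map ?z (subst (Suc a) u v) = subst a (map ?z u) w'"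
          using rigid_set[OF w'(2)] u(1) by (auto simp: v_def letter_def subset_iff)
        ultimately show ?thesis using w'(3)[OF _ zu] u(1) by (simp del: map_map)
      qed
      ultimately show "\<exists>w col. length w = n \<and> rigid (Suc a) (Suc a + m) w \<and>
        (\<forall>u. length u = m \<and> rigid (Suc a) (Suc a + 0) u \<longrightarrow> \<kappa> (subst (Suc a) u w) = col)"
        using w(1) by (intro exI[of _ "subst (Suc a) v w"] exI[of _ col]) auto
    qed
    then show ?thesis by blast
  qed
qed

section \<open>Homogeneity of constant prefixes\<close>

text \<open>Induction on \<open>m\<close>. All constant instances of a Hales-Jewett word
  \<open>h\<close> share a colour; a new parameter placed after \<open>h\<close> makes it the colour
  belonging to prefix length \<open>m\<close>, and shorter prefixes fall to the induction
  hypothesis.\<close>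

lemma prefix_length_ramsey:
  "\<exists>n. \<forall>\<kappa> :: nat list \<Rightarrow> nat. (\<forall>u. \<kappa> u < r) \<longrightarrow>
    (\<exists>w d. length w = n \<and> rigid a (a + m) w \<and>
      (\<forall>u. length u = m \<and> \<not> set u \<subseteq> {..<a} \<longrightarrow>
        \<kappa> (constant_prefix a (subst a u w)) = d (length (constant_prefix a u))))"
proof (induction m)
  case 0
  show ?case by (intro exI[of _ 0]) auto
next
  case (Suc m)
  then obtain n1 where n1: "\<And>\<kappa> :: nat list \<Rightarrow> nat. (\<And>u. \<kappa> u < r) \<Longrightarrow>
    \<exists>w d. length w = n1 \<and> rigid a (a + m) w \<and>
      (\<forall>u. length u = m \<and> \<not> set u \<subseteq> {..<a} \<longrightarrow>
        \<kappa> (constant_prefix a (subst a u w)) = d (length (constant_prefix a u)))"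
    by blast
  obtain M where M: "ramsey 0 a n1 r M" using hales_jewett by blast
  show ?case
  proof (intro exI[of _ "Suc M"] allI impI)
    fix \<kappa> :: "nat list \<Rightarrow> nat" assume \<kappa>: "\<forall>u. \<kappa> u < r"
    obtain h col where h: "length h = M" "rigid a (a + n1) h"
      "\<And>u. \<lbrakk>length u = n1; rigid a (a + 0) u\<rbrakk> \<Longrightarrow> \<kappa> (subst a u h) = col"
      using ramseyD[OF M, of \<kappa>] \<kappa> by blast
    \<comment> \<open>By \<open>constant_prefix_subst\<close>, the colour of the constant prefix of
      \<open>h\<close> when its parameters are filled with \<open>q\<close> followed by a
      nonconstant letter.\<close>
    define \<kappa>' where "\<kappa>' q = \<kappa> (subst a q (takeWhile (\<lambda>c. c < a + length q) h))" for q
    obtain w d where w: "length w = n1" "rigid a (a + m) w"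
      "\<And>u. \<lbrakk>length u = m; \<not> set u \<subseteq> {..<a}\<rbrakk> \<Longrightarrow>
        \<kappa>' (constant_prefix a (subst a u w)) = d (length (constant_prefix a u))"
      using n1[of \<kappa>'] \<kappa> unfolding \<kappa>'_def by blast
    let ?W = "subst a w h @ [a + m]"
    have "rigid a (a + m) (subst a w h)" using h w by (intro rigid_subst[OF h(2)]) auto
    then have W: "rigid a (a + Suc m) ?W" by (rule rigid_append) simp
    have "\<kappa> (constant_prefix a (subst a u ?W)) = (d(m := col)) (length (constant_prefix a u))"
      if u: "length u = Suc m" "\<not> set u \<subseteq> {..<a}" for u
    proof -
      obtain u' x where ux: "u = u' @ [x]" "length u' = m"
        using u by (cases u rule: rev_cases) auto
      have W_eq: "subst a u ?W = subst a (subst a u' w) h @ [x]"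
      proof -
        have "subst a u (subst a w h) = subst a (subst a u w) h"
          using rigid_set[OF h(2)] w(1) by (intro subst_subst) simp
        also have "subst a u w = subst a u' w"
          using subst_append_left[of w a u' "[x]"] rigid_set[OF w(2)] ux by simp
        finally show ?thesis using ux by (simp add: letter_def nth_append)
      qed
      let ?y = "subst a u' w"
      show ?thesis
      proof (cases "set u' \<subseteq> {..<a}")
        case True
        then have x: "a \<le> x" using u(2) ux by auto
        have y: "set ?y \<subseteq> {..<a}" using set_subst_constant[OF w(2) ux(2) True] .
        have yh: "set (subst a ?y h) \<subseteq> {..<a}"
          using set_subst_constant[OF h(2) _ y] w(1) by simp
        have "\<forall>c \<in> set u'. c < a" using True by auto
        then have "constant_prefix a u = u'" using ux(1) x by (simp only: takeWhile_append2) simp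
        moreover have "\<forall>c \<in> set (subst a ?y h). c < a"
          using yh by auto
        then have "constant_prefix a (subst a u ?W) = subst a ?y h"
          unfolding W_eq using x by (simp only: takeWhile_append2) simp
        moreover have "\<kappa> (subst a ?y h) = col" using h(3)[of ?y] y w(1) rigid_const_iff[of a ?y] by simp
        ultimately show ?thesis using ux by simp
      next
        case False
        have y: "\<not> set ?y \<subseteq> {..<a}" using not_constant_subst[OF w(2) ux(2) False] .
        have yh: "\<not> set (subst a ?y h) \<subseteq> {..<a}"
          using not_constant_subst[OF h(2) _ y] w(1) by simp
        obtain z v where zv: "?y = constant_prefix a ?y @ z # v" "a \<le> z"
          using constant_prefix_decomp[OF y] .
        have len: "length (constant_prefix a ?y) < n1"
          using arg_cong[OF zv(1), of length] w(1) by simp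
        have "constant_prefix a (subst a u ?W) = constant_prefix a (subst a ?y h)"
          unfolding W_eq using yh by (auto intro!: takeWhile_append1)
        also have "\<dots> = subst a (constant_prefix a ?y)
            (takeWhile (\<lambda>c. c < a + length (constant_prefix a ?y)) h)"
          using constant_prefix_subst[OF h(2) len set_constant_prefix zv(2), of v] zv(1) by simp
        finally have "\<kappa> (constant_prefix a (subst a u ?W)) = \<kappa>' (constant_prefix a ?y)"
          by (simp add: \<kappa>'_def)
        also have "\<dots> = d (length (constant_prefix a u'))" using w(3) ux(2) False by blast
        also have "constant_prefix a u' = constant_prefix a u"
          using False ux(1) by (auto intro!: takeWhile_append1[symmetric])
        finally have "\<kappa> (constant_prefix a (subst a u ?W)) = d (length (constant_prefix a u))" .
        moreover have "length (constant_prefix a u) \<noteq> m"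
        proof -
          obtain z' v' where u': "u' = constant_prefix a u' @ z' # v'"
            using constant_prefix_decomp[OF False] by metis
          have "length (constant_prefix a u') < m"
            using ux(2) arg_cong[OF u', of length] by simp
          then show ?thesis using \<open>constant_prefix a u' = constant_prefix a u\<close> by simp
        qed
        ultimately show ?thesis by simp
      qed
    qed
    moreover have "length ?W = Suc M" using h(1) by simp
    ultimately show "\<exists>w d. length w = Suc M \<and> rigid a (a + Suc m) w \<and>
      (\<forall>u. length u = Suc m \<and> \<not> set u \<subseteq> {..<a} \<longrightarrow>
        \<kappa> (constant_prefix a (subst a u w)) = d (length (constant_prefix a u)))"
      using W by blast
  qed
qed

text \<open>Serves to discard the parameters outside \<open>J\<close>: those positions receive the
  letter 0, a constant since \<open>a \<ge> 1\<close>.\<close>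

lemma word_with_parameters_in:
  assumes "a \<ge> 1"
  shows "\<exists>w. length w = N \<and> rigid a (a + card {i \<in> J. i < N}) w \<and> (\<forall>i<N. a \<le> w ! i \<longrightarrow> i \<in> J)"
proof (induction N)
  case 0
  show ?case by simp
next
  case (Suc N)
  then obtain w where w: "length w = N" "rigid a (a + card {i \<in> J. i < N}) w"
    "\<And>i. \<lbrakk>i < N; a \<le> w ! i\<rbrakk> \<Longrightarrow> i \<in> J" by blast
  show ?case
  proof (cases "N \<in> J")
    case True
    then have "{i \<in> J. i < Suc N} = insert N {i \<in> J. i < N}" by (auto simp: less_Suc_eq)
    then have "rigid (a + card {i \<in> J. i < N}) (a + card {i \<in> J. i < Suc N}) [a + card {i \<in> J. i < N}]"
      by simp
    then show ?thesis using w True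
      by (intro exI[of _ "w @ [a + card {i \<in> J. i < N}]"])
        (auto intro: rigid_append simp: nth_append less_Suc_eq)
  next
    case False
    then have "{i \<in> J. i < Suc N} = {i \<in> J. i < N}" by (auto simp: less_Suc_eq)
    then have "rigid (a + card {i \<in> J. i < N}) (a + card {i \<in> J. i < Suc N}) [0]"
      using assms by simp
    then show ?thesis using w False assms
      by (intro exI[of _ "w @ [0]"]) (auto intro: rigid_append simp: nth_append less_Suc_eq)
  qed
qed

text \<open>Pigeonhole over prefix lengths: if parameters stand only at positions \<open>j\<close>
  where prefixes of length \<open>j\<close> have colour \<open>col\<close>, then every nonconstant
  instance has its first nonconstant letter at such a position.\<close>

lemma prefix_ramsey:
  "\<exists>n. \<forall>\<kappa> :: nat list \<Rightarrow> nat. (\<forall>u. \<kappa> u < r) \<longrightarrow>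
    (\<exists>w col. length w = n \<and> rigid a (a + m) w \<and>
      (\<forall>u. length u = m \<and> \<not> set u \<subseteq> {..<a} \<longrightarrow> \<kappa> (constant_prefix a (subst a u w)) = col))"
proof (cases "a = 0 \<or> m = 0")
  \<comment> \<open>No constant letters or no positions: all constant prefixes are empty.\<close>
  case True
  have "\<exists>w. length w = m \<and> rigid a (a + m) w"
    using rigid_upt[of a m] by (intro exI[of _ "[a..<a + m]"]) simp
  moreover have "constant_prefix a (subst a u w) = []" if "length w = m" for u w :: "nat list"
    using that True by (cases w) auto
  ultimately show ?thesis by (intro exI[of _ m]) metis
next
  case False
  \<comment> \<open>With \<open>m * r\<close> lengths and \<open>r\<close> colours, some colour is
    taken at \<open>m\<close> lengths or more.\<close>
  let ?N = "m * r"
  obtain n where n: "\<And>\<kappa> :: nat list \<Rightarrow> nat. (\<And>u. \<kappa> u < r) \<Longrightarrow>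
    \<exists>w d. length w = n \<and> rigid a (a + ?N) w \<and>
      (\<forall>u. length u = ?N \<and> \<not> set u \<subseteq> {..<a} \<longrightarrow>
        \<kappa> (constant_prefix a (subst a u w)) = d (length (constant_prefix a u)))"
    using prefix_length_ramsey[of r a ?N] by blast
  show ?thesis
  proof (intro exI[of _ n] allI impI)
    fix \<kappa> :: "nat list \<Rightarrow> nat" assume \<kappa>: "\<forall>u. \<kappa> u < r"
    then have r: "r > 0" by (metis gr_implies_not0 gr0I)
    obtain w d where w: "length w = n" "rigid a (a + ?N) w"
      "\<And>u. \<lbrakk>length u = ?N; \<not> set u \<subseteq> {..<a}\<rbrakk> \<Longrightarrow>
        \<kappa> (constant_prefix a (subst a u w)) = d (length (constant_prefix a u))"
      using n[of \<kappa>] \<kappa> by blast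
    \<comment> \<open>No bound on \<open>d\<close> is given; the default 0 forces \<open>r\<close>
      colours for the count, and \<open>d'\<close> agrees with \<open>d\<close> wherever
      \<open>d\<close> is a value of \<open>\<kappa>\<close>.\<close>
    define d' where "d' j = (if d j < r then d j else 0)" for j
    have "\<exists>col<r. m \<le> card {j \<in> {..<?N}. d' j = col}"
    proof (rule ccontr)
      assume "\<not> ?thesis"
      then have *: "card {j \<in> {..<?N}. d' j = col} < m" if "col < r" for col using that by force
      have eq: "(\<Union>col<r. {j \<in> {..<?N}. d' j = col}) = {..<?N}" using r by (auto simp: d'_def)
      have "?N \<le> (\<Sum>col<r. card {j \<in> {..<?N}. d' j = col})"
        using card_UN_le[of "{..<r}" "\<lambda>col. {j \<in> {..<?N}. d' j = col}"] unfolding eq by simp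
      also have "\<dots> < (\<Sum>col<r. m)" using * r by (intro sum_strict_mono) auto
      finally show False by (simp add: mult.commute)
    qed
    then obtain col where "m \<le> card {j \<in> {..<?N}. d' j = col}" by blast
    then obtain J where "J \<subseteq> {j \<in> {..<?N}. d' j = col}" "card J = m"
      by (rule obtain_subset_with_card_n)
    then have J: "J \<subseteq> {..<?N}" "card J = m" "\<And>j. j \<in> J \<Longrightarrow> d' j = col" by auto
    have "{i \<in> J. i < ?N} = J" using J(1) by auto
    then obtain v where v: "length v = ?N" "rigid a (a + m) v"
      "\<And>i. \<lbrakk>i < ?N; a \<le> v ! i\<rbrakk> \<Longrightarrow> i \<in> J"
      using word_with_parameters_in[of a ?N J] False J(2) by auto
    have "\<kappa> (constant_prefix a (subst a u (subst a v w))) = col"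
      if u: "length u = m" "\<not> set u \<subseteq> {..<a}" for u
    proof -
      let ?y = "subst a u v"
      have y: "\<not> set ?y \<subseteq> {..<a}" using not_constant_subst[OF v(2) u] .
      obtain x z where x: "?y = constant_prefix a ?y @ x # z" "a \<le> x"
        using constant_prefix_decomp[OF y] .
      \<comment> \<open>The position of the first nonconstant letter of \<open>?y\<close>. Such a
        letter comes from a parameter of \<open>v\<close>, so \<open>i\<close> lies in
        \<open>J\<close>.\<close>
      define i where "i = length (constant_prefix a ?y)"
      have i: "i < ?N" using arg_cong[OF x(1), of length] v(1) by (simp add: i_def)
      have "?y ! i = x" using x(1) unfolding i_def by (metis nth_append_length)
      then have "letter a u (v ! i) = x" using i v(1) by simp
      then have "a \<le> v ! i" using x(2) by (auto simp: letter_def split: if_splits)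
      then have "d' i = col" using v(3) i J(3) by blast
      moreover have "subst a u (subst a v w) = subst a ?y w"
        using rigid_set[OF w(2)] v(1) by (intro subst_subst) simp
      moreover have "\<kappa> (constant_prefix a (subst a ?y w)) = d i"
        using w(3)[of ?y] v(1) y unfolding i_def by simp
      moreover have "d i < r" using \<kappa> calculation(3) by metis
      ultimately show ?thesis by (simp add: d'_def del: map_map)
    qed
    moreover have "rigid a (a + m) (subst a v w)"
      using rigid_subst[OF w(2) _ v(2)] v(1) by simp
    ultimately show "\<exists>w col. length w = n \<and> rigid a (a + m) w \<and>
      (\<forall>u. length u = m \<and> \<not> set u \<subseteq> {..<a} \<longrightarrow> \<kappa> (constant_prefix a (subst a u w)) = col)"
      using w(1) by (intro exI[of _ "subst a v w"] exI[of _ col]) (simp del: map_map)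
  qed
qed

section \<open>From \<open>k\<close> to \<open>k + 1\<close> parameters\<close>

lemma word_cases_prefix:
  assumes "rigid a (a + Suc k) u"
  obtains v where "u = constant_prefix a u @ a # v" "rigid (Suc a) (Suc a + k) v"
proof -
  have "\<exists>v. u = constant_prefix a u @ a # v \<and> rigid (Suc a) (Suc a + k) v"
    using assms by (induction u) auto
  then show ?thesis using that by blast
qed

text \<open>A word \<open>u\<close> with \<open>k + 1\<close> parameters is \<open>p @ a # v\<close>, where \<open>p\<close> is constant and \<open>v\<close> is a word with \<open>k\<close>
  parameters over the alphabet enlarged by the letter \<open>a\<close>. The \<open>i\<close>-th step applies the theorem for \<open>k\<close> to
  the words \<open>v\<close>, coloured by all constant prefixes \<open>p\<close> of length \<open>i\<close> at once.\<close>

lemma ramsey_prefix_aux: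
  assumes "\<And>a m r. \<exists>n. ramsey k a m r n"
  shows "\<exists>n. \<forall>\<kappa> :: nat list \<Rightarrow> nat. (\<forall>u. \<kappa> u < r) \<longrightarrow>
    (\<exists>w \<psi>. length w = n \<and> rigid a (a + (i + M)) w \<and>
      (\<forall>u. length u = i + M \<and> rigid a (a + Suc k) u \<and> length (constant_prefix a u) < i \<longrightarrow>
        \<kappa> (subst a u w) = \<psi> (constant_prefix a u)))"
proof (induction i arbitrary: M)
  case 0
  show ?case
    using rigid_upt[of a M] by (intro exI[of _ M] allI impI exI[of _ "[a..<a + M]"]) simp
next
  case (Suc i)
  define P where "P = {p. set p \<subseteq> {..<a} \<and> length p = i}"
  have P: "finite P" "card P = a ^ i"
    unfolding P_def using finite_lists_length_eq[of "{..<a}" i] card_lists_length_eq[of "{..<a}" i]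
    by simp_all
  \<comment> \<open>The colours are the functions from the \<open>a ^ i\<close> constant words of
    length \<open>i\<close> to the \<open>r\<close> colours.\<close>
  obtain M1 where M1: "ramsey k (Suc a) M (r ^ (a ^ i)) M1" using assms by blast
  obtain n where n: "\<And>\<kappa> :: nat list \<Rightarrow> nat. (\<And>u. \<kappa> u < r) \<Longrightarrow>
    \<exists>w \<psi>. length w = n \<and> rigid a (a + (i + Suc M1)) w \<and>
      (\<forall>u. length u = i + Suc M1 \<and> rigid a (a + Suc k) u \<and> length (constant_prefix a u) < i \<longrightarrow>
        \<kappa> (subst a u w) = \<psi> (constant_prefix a u))"
    using Suc.IH[of "Suc M1"] by blast
  show ?case
  proof (intro exI[of _ n] allI impI)
    fix \<kappa> :: "nat list \<Rightarrow> nat" assume \<kappa>: "\<forall>u. \<kappa> u < r"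
    obtain w \<psi> where w: "length w = n" "rigid a (a + (i + Suc M1)) w"
      "\<And>u. \<lbrakk>length u = i + Suc M1; rigid a (a + Suc k) u; length (constant_prefix a u) < i\<rbrakk> \<Longrightarrow>
        \<kappa> (subst a u w) = \<psi> (constant_prefix a u)"
      using n[of \<kappa>] \<kappa> by blast
    obtain e :: "nat list \<Rightarrow> nat" where e: "\<And>v. e v < r ^ (a ^ i)"
      "\<And>v v' p. \<lbrakk>e v = e v'; p \<in> P\<rbrakk> \<Longrightarrow>
        \<kappa> (subst a (p @ a # v) w) = \<kappa> (subst a (p @ a # v') w)"
      using encode_vectors[of P "{..<r}" "\<lambda>v p. \<kappa> (subst a (p @ a # v) w)"] P \<kappa> by auto
    obtain z col where z: "length z = M1" "rigid (Suc a) (Suc a + M) z"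
      "\<And>v. \<lbrakk>length v = M; rigid (Suc a) (Suc a + k) v\<rbrakk> \<Longrightarrow> e (subst (Suc a) v z) = col"
      using ramseyD[OF M1, of e] e(1) by blast
    \<comment> \<open>\<open>y\<close> starts with the first \<open>i + 1\<close> parameters, so the
      beginning of \<open>u\<close> is copied unchanged. The constant \<open>a\<close> of
      \<open>z\<close> becomes the parameter \<open>a + i\<close>, which takes the value
      \<open>a\<close> again when the constant prefix of \<open>u\<close> has length
      \<open>i\<close>.\<close>
    define z' where "z' = map (\<lambda>c. if c < a then c else c + i) z"
    define y where "y = [a..<a + Suc i] @ z'"
    have "rigid (a + Suc i) (a + (Suc i + M)) z'"
      using rigid_shift[OF z(2), of a i] by (simp add: z'_def add_ac)
    then have y: "rigid a (a + (Suc i + M)) y"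
      unfolding y_def using rigid_upt[of a "Suc i"] rigid_append by blast
    have ylen: "length y = i + Suc M1" using z(1) by (simp add: y_def z'_def)
    have u_y: "subst a u y = take (Suc i) u @ subst a u z'" if "length u = Suc i + M" for u
    proof -
      have "subst a u [a..<a + Suc i] = take (Suc i) u"
        using that by (intro nth_equalityI) (simp_all add: letter_def del: upt_Suc)
      then show ?thesis by (simp add: y_def)
    qed
    have "\<exists>\<psi>'. \<forall>u. length u = Suc i + M \<and> rigid a (a + Suc k) u
        \<and> length (constant_prefix a u) < Suc i
      \<longrightarrow> \<kappa> (subst a u (subst a y w)) = \<psi>' (constant_prefix a u)"
    proof (intro exI allI impI, elim conjE)
      fix u
      assume u: "length u = Suc i + M" "rigid a (a + Suc k) u"
        "length (constant_prefix a u) < Suc i"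
      let ?p = "constant_prefix a u"
      obtain v where v: "u = ?p @ a # v" "rigid (Suc a) (Suc a + k) v"
        using word_cases_prefix[OF u(2)] .
      have uyw: "subst a u (subst a y w) = subst a (subst a u y) w"
        using rigid_set[OF w(2)] ylen by (intro subst_subst) simp
      \<comment> \<open>Prefixes shorter than \<open>i\<close> keep their value under
        \<open>\<psi>\<close>. At length \<open>i\<close> any \<open>v\<close> with
        \<open>e v = col\<close> gives the right colour, and a fixed choice makes it independent of
        \<open>u\<close>.\<close>
      show "\<kappa> (subst a u (subst a y w)) = (\<lambda>p. if length p < i then \<psi> p else
          \<kappa> (subst a (p @ a # (SOME v. e v = col)) w)) ?p"
      proof (cases "length ?p < i")
        case True
        have "take (Suc i) u = ?p @ a # take (i - length ?p) v"
          using True by (subst v(1)) (simp add: Suc_diff_le)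
        then have "constant_prefix a (subst a u y) = ?p"
          unfolding u_y[OF u(1)] using set_constant_prefix[of a u]
          by (auto simp: takeWhile_append2 subset_iff simp del: takeWhile_eq_all_conv)
        moreover have "rigid a (a + Suc k) (subst a u y)"
          using rigid_subst[OF y _ u(2)] u(1) by simp
        ultimately show ?thesis
          using w(3)[of "subst a u y"] True ylen uyw by (simp del: map_map)
      next
        case False
        then have p: "length ?p = i" using u(3) by simp
        have vlen: "length v = M" using arg_cong[OF v(1), of length] u(1) p by simp
        have "subst a u z' = subst (Suc a) v z"
        proof -
          have "letter a u (if c < a then c else c + i) = letter (Suc a) v c" if "c \<in> set z" for c
            by (subst v(1)) (auto simp: letter_def nth_append p Suc_diff_le not_less_eq nth_Cons'
              Suc_le_eq)
          then show ?thesis by (simp add: z'_def)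
        qed
        moreover have "take (Suc i) u = ?p @ [a]" using p by (subst v(1)) simp
        ultimately have uy: "subst a u y = ?p @ a # subst (Suc a) v z"
          using u_y[OF u(1)] by simp
        have ecol: "e (subst (Suc a) v z) = col" using z(3) vlen v(2) by blast
        have "e (subst (Suc a) v z) = e (SOME v. e v = col)"
          using someI[of "\<lambda>v. e v = col", OF ecol] ecol by (rule trans[OF _ sym, rotated])
        moreover have "?p \<in> P" using p set_constant_prefix[of a u] by (simp add: P_def)
        ultimately have "\<kappa> (subst a (?p @ a # subst (Suc a) v z) w)
            = \<kappa> (subst a (?p @ a # (SOME v. e v = col)) w)" by (rule e(2))
        then show ?thesis unfolding uyw uy using p by simp
      qed
    qed
    moreover have "rigid a (a + (Suc i + M)) (subst a y w)"
      using rigid_subst[OF w(2) _ y] ylen by simp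
    ultimately show "\<exists>w \<psi>. length w = n \<and> rigid a (a + (Suc i + M)) w \<and>
      (\<forall>u. length u = Suc i + M \<and> rigid a (a + Suc k) u \<and> length (constant_prefix a u) < Suc i \<longrightarrow>
        \<kappa> (subst a u w) = \<psi> (constant_prefix a u))"
      using w(1) by (metis length_map)
  qed
qed

text \<open>The case \<open>i = m\<close>, \<open>M = 0\<close>: the first parameter follows the
  constant prefix, so the bound on the prefix length holds automatically.\<close>

lemma ramsey_prefix:
  assumes "\<And>a m r. \<exists>n. ramsey k a m r n"
  shows "\<exists>n. \<forall>\<kappa> :: nat list \<Rightarrow> nat. (\<forall>u. \<kappa> u < r) \<longrightarrow>
    (\<exists>w \<psi>. length w = n \<and> rigid a (a + m) w \<and>
      (\<forall>u. length u = m \<and> rigid a (a + Suc k) u \<longrightarrow>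
        \<kappa> (subst a u w) = \<psi> (constant_prefix a u)))"
proof -
  have "length (constant_prefix a u) < length u" if u: "rigid a (a + Suc k) u" for u
  proof -
    obtain v where v: "u = constant_prefix a u @ a # v" by (rule word_cases_prefix[OF u])
    from arg_cong[OF v, of length] show ?thesis by simp
  qed
  then have "(length u = m \<and> rigid a (a + Suc k) u \<and> length (constant_prefix a u) < m)
      = (length u = m \<and> rigid a (a + Suc k) u)" for u
    by blast
  then show ?thesis
    using ramsey_prefix_aux[of k r a m 0, OF assms] unfolding add_0_right by simp
qed

text \<open>Two words are composed: \<open>w\<close> makes the colour a function
  \<open>\<psi>\<close> of the constant prefix, then \<open>v\<close> makes \<open>\<psi>\<close>
  constant. The lengths are fixed in the opposite order.\<close>

theorem graham_rothschild: "\<exists>n. ramsey k a m r n"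
proof (induction k arbitrary: a m r)
  case 0
  show ?case by (rule hales_jewett)
next
  case (Suc k)
  obtain n1 where n1: "\<And>\<kappa> :: nat list \<Rightarrow> nat. (\<And>u. \<kappa> u < r) \<Longrightarrow>
    \<exists>w col. length w = n1 \<and> rigid a (a + m) w \<and>
      (\<forall>u. length u = m \<and> \<not> set u \<subseteq> {..<a} \<longrightarrow> \<kappa> (constant_prefix a (subst a u w)) = col)"
    using prefix_ramsey[of r a m] by blast
  obtain n where n: "\<And>\<kappa> :: nat list \<Rightarrow> nat. (\<And>u. \<kappa> u < r) \<Longrightarrow>
    \<exists>w \<psi>. length w = n \<and> rigid a (a + n1) w \<and>
      (\<forall>u. length u = n1 \<and> rigid a (a + Suc k) u \<longrightarrow>
        \<kappa> (subst a u w) = \<psi> (constant_prefix a u))"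
    using ramsey_prefix[of k r a n1] Suc.IH by blast
  have "ramsey (Suc k) a m r n"
    unfolding ramsey_def
  proof (intro allI impI)
    fix \<kappa> :: "nat list \<Rightarrow> nat" assume \<kappa>: "\<forall>u. \<kappa> u < r"
    then have r: "r > 0" by (metis gr_implies_not0 gr0I)
    obtain w \<psi> where w: "length w = n" "rigid a (a + n1) w"
      "\<And>u. \<lbrakk>length u = n1; rigid a (a + Suc k) u\<rbrakk> \<Longrightarrow> \<kappa> (subst a u w) = \<psi> (constant_prefix a u)"
      using n[of \<kappa>] \<kappa> by blast
    define \<psi>' where "\<psi>' p = (if \<psi> p < r then \<psi> p else 0)" for p
    have "\<psi>' p < r" for p using r by (simp add: \<psi>'_def)
    then obtain v col where v: "length v = n1" "rigid a (a + m) v"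
      "\<And>u. \<lbrakk>length u = m; \<not> set u \<subseteq> {..<a}\<rbrakk> \<Longrightarrow> \<psi>' (constant_prefix a (subst a u v)) = col"
      using n1[of \<psi>'] by blast
    have "\<kappa> (subst a u (subst a v w)) = col" if u: "length u = m" "rigid a (a + Suc k) u" for u
    proof -
      have "rigid a (a + Suc k) (subst a u v)" using rigid_subst[OF v(2)] u by simp
      then have "\<kappa> (subst a (subst a u v) w) = \<psi> (constant_prefix a (subst a u v))"
        using w(3)[of "subst a u v"] v(1) by (simp del: map_map)
      moreover from this have "\<psi> (constant_prefix a (subst a u v)) < r" using \<kappa> by metis
      moreover have "\<not> set u \<subseteq> {..<a}" using subsetD[OF rigid_surj[OF u(2)], of a] by auto
      then have "\<psi>' (constant_prefix a (subst a u v)) = col" using v(3) u(1) by blast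
      moreover have "subst a u (subst a v w) = subst a (subst a u v) w"
        using rigid_set[OF w(2)] v(1) by (intro subst_subst) simp
      ultimately show ?thesis by (simp add: \<psi>'_def del: map_map)
    qed
    moreover have "rigid a (a + m) (subst a v w)"
      using rigid_subst[OF w(2) _ v(2)] v(1) by simp
    ultimately show "\<exists>w col. length w = n \<and> rigid a (a + m) w \<and>
      (\<forall>u. length u = m \<and> rigid a (a + Suc k) u \<longrightarrow> \<kappa> (subst a u w) = col)"
      using w(1) by (metis length_map)
  qed
  then show ?case by blast
qed

section \<open>Maximal chains as orders on clopen sets\<close>

text \<open>The empty set is left out: it is disjoint from itself, so totality and the last axiom of
  \<open>clopen_order\<close> would conflict.\<close>

definition clopens :: "'a topology \<Rightarrow> 'a set set" where
  "clopens X = {A. openin X A \<and> closedin X A \<and> A \<noteq> {}}"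

text \<open>The order in which the members of a maximal chain of closed sets, taken from small to large, hit
  the clopen sets: \<open>R A B\<close> means that \<open>A\<close> is hit no later than \<open>B\<close>.\<close>

definition clopen_order :: "'a topology \<Rightarrow> ('a set \<Rightarrow> 'a set \<Rightarrow> bool) \<Rightarrow> bool" where
  "clopen_order X R \<longleftrightarrow>
     (\<forall>A\<in>clopens X. \<forall>B\<in>clopens X. R A B \<or> R B A) \<and>
     (\<forall>A\<in>clopens X. \<forall>B\<in>clopens X. \<forall>C\<in>clopens X. R A B \<longrightarrow> R B C \<longrightarrow> R A C) \<and>
     (\<forall>A\<in>clopens X. \<forall>B\<in>clopens X. \<forall>C\<in>clopens X. R (A \<union> B) C \<longleftrightarrow> R A C \<or> R B C) \<and>
     (\<forall>A\<in>clopens X. \<forall>B\<in>clopens X. A \<inter> B = {} \<longrightarrow> \<not> (R A B \<and> R B A))"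

definition chain_order :: "'a set set \<Rightarrow> 'a set \<Rightarrow> 'a set \<Rightarrow> bool" where
  "chain_order c A B \<longleftrightarrow> (\<forall>F\<in>c. F \<inter> B \<noteq> {} \<longrightarrow> F \<inter> A \<noteq> {})"

text \<open>The inverse of \<open>chain_order\<close>. All compatible closed sets are collected, so
  that a set outside it violates a definite comparison \<open>R A B\<close>.\<close>

definition order_chain :: "'a topology \<Rightarrow> ('a set \<Rightarrow> 'a set \<Rightarrow> bool) \<Rightarrow> 'a set set" where
  "order_chain X R = {K \<in> hyp X. \<forall>A\<in>clopens X. \<forall>B\<in>clopens X. R A B \<longrightarrow> K \<inter> B \<noteq> {} \<longrightarrow> K \<inter> A \<noteq> {}}"

lemma clopen_Un: "A \<in> clopens X \<Longrightarrow> B \<in> clopens X \<Longrightarrow> A \<union> B \<in> clopens X"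
  by (auto simp: clopens_def)

lemma clopen_Diff: "A \<in> clopens X \<Longrightarrow> B \<in> clopens X \<Longrightarrow> A - B \<noteq> {} \<Longrightarrow> A - B \<in> clopens X"
  by (auto simp: clopens_def openin_diff closedin_diff)

lemma clopen_subset: "A \<in> clopens X \<Longrightarrow> A \<subseteq> topspace X"
  by (auto simp: clopens_def openin_subset)

lemma clopen_order_total: "clopen_order X R \<Longrightarrow> A \<in> clopens X \<Longrightarrow> B \<in> clopens X \<Longrightarrow> R A B \<or> R B A"
  and clopen_order_trans: "clopen_order X R \<Longrightarrow> A \<in> clopens X \<Longrightarrow> B \<in> clopens X \<Longrightarrow> C \<in> clopens X
    \<Longrightarrow> R A B \<Longrightarrow> R B C \<Longrightarrow> R A C"
  and clopen_order_Un: "clopen_order X R \<Longrightarrow> A \<in> clopens X \<Longrightarrow> B \<in> clopens X \<Longrightarrow> C \<in> clopens X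
    \<Longrightarrow> R (A \<union> B) C \<longleftrightarrow> R A C \<or> R B C"
  and clopen_order_disjoint: "clopen_order X R \<Longrightarrow> A \<in> clopens X \<Longrightarrow> B \<in> clopens X
    \<Longrightarrow> A \<inter> B = {} \<Longrightarrow> R A B \<Longrightarrow> \<not> R B A"
  unfolding clopen_order_def by blast+

lemma clopen_order_refl: "clopen_order X R \<Longrightarrow> A \<in> clopens X \<Longrightarrow> R A A"
  using clopen_order_total by blast

lemma clopen_order_mono:
  assumes "clopen_order X R" "A \<in> clopens X" "B \<in> clopens X" "C \<in> clopens X" "A \<subseteq> B" "R A C"
  shows "R B C"
  using clopen_order_Un[OF assms(1-4)] assms(5,6) by (simp add: Un_absorb1)

lemma clopen_order_superset: "clopen_order X R \<Longrightarrow> A \<in> clopens X \<Longrightarrow> B \<in> clopens X \<Longrightarrow> A \<subseteq> B \<Longrightarrow> R B A"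
  using clopen_order_mono clopen_order_refl by blast

text \<open>By the union axiom \<open>A \<union> B\<close> is equivalent to whichever of
  \<open>A\<close> and \<open>B\<close> comes first.\<close>

lemma clopen_order_Un_right:
  assumes R: "clopen_order X R" and "A \<in> clopens X" "B \<in> clopens X" "C \<in> clopens X"
  shows "R C (A \<union> B) \<longleftrightarrow> R C A \<and> R C B"
proof -
  have AB: "A \<union> B \<in> clopens X" using assms clopen_Un by blast
  have "R (A \<union> B) A" "R (A \<union> B) B"
    using clopen_order_superset[OF R] AB assms by blast+
  moreover have "R A (A \<union> B) \<or> R B (A \<union> B)"
    using clopen_order_Un[OF R assms(2,3) AB] clopen_order_refl[OF R AB] by blast
  ultimately show ?thesis using clopen_order_trans[OF R] AB assms by meson
qed

lemma clopen_order_Union: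
  assumes R: "clopen_order X R" and "finite \<D>" "\<D> \<noteq> {}" "\<D> \<subseteq> clopens X" "B \<in> clopens X"
  shows "\<Union>\<D> \<in> clopens X \<and> (R (\<Union>\<D>) B \<longleftrightarrow> (\<exists>D\<in>\<D>. R D B)) \<and> (R B (\<Union>\<D>) \<longleftrightarrow> (\<forall>D\<in>\<D>. R B D))"
  using assms(2-4)
proof (induction rule: finite_ne_induct)
  case (insert D \<D>)
  then show ?case
    using clopen_order_Un[OF R, of D "\<Union>\<D>" B] clopen_order_Un_right[OF R, of D "\<Union>\<D>" B]
      clopen_Un[of D X "\<Union>\<D>"] assms(5) by auto
qed auto

section \<open>Orders and maximal chains determine each other\<close>

locale zero_dimensional_compactum =
  fixes X :: "'a topology"
  assumes compact: "compact_space X" and Hausdorff: "Hausdorff_space X" and dim0: "X dim_le 0"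
    and nonempty: "topspace X \<noteq> {}"
begin

lemma clopen_neighbourhood:
  assumes "openin X U" "x \<in> U"
  obtains C where "C \<in> clopens X" "x \<in> C" "C \<subseteq> U"
proof -
  have "neighbourhood_base_of (\<lambda>U. closedin X U \<and> openin X U) X"
    using dim0 by (simp add: dimension_le_0_neighbourhood_base_of_clopen)
  then obtain V C where "openin X V" "closedin X C \<and> openin X C" "x \<in> V" "V \<subseteq> C" "C \<subseteq> U"
    using assms openin_subset[OF assms(1)]
    unfolding neighbourhood_base_of_def neighbourhood_base_at_def by (meson subsetD)
  then show ?thesis using that[of C] by (auto simp: clopens_def)
qed

lemma clopen_miss_closed:
  assumes "closedin X K" "x \<in> topspace X" "x \<notin> K"
  obtains C where "C \<in> clopens X" "x \<in> C" "C \<inter> K = {}"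
  using clopen_neighbourhood[of "topspace X - K" x] assms openin_diff[OF openin_topspace assms(1)]
  by (metis Diff_iff Diff_eq_empty_iff Int_Diff Int_absorb1 Int_commute disjoint_iff subsetD)

text \<open>The first member of the chain of \<open>R\<close> that hits \<open>B\<close>.\<close>

definition cut :: "('a set \<Rightarrow> 'a set \<Rightarrow> bool) \<Rightarrow> 'a set \<Rightarrow> 'a set" where
  "cut R B = {x \<in> topspace X. \<forall>C\<in>clopens X. x \<in> C \<longrightarrow> R C B}"

lemma closedin_cut: "closedin X (cut R B)"
proof -
  have "topspace X - cut R B = \<Union>{C \<in> clopens X. \<not> R C B}"
    using clopen_subset by (fastforce simp: cut_def)
  moreover have "openin X (\<Union>{C \<in> clopens X. \<not> R C B})" by (auto simp: clopens_def)
  ultimately show ?thesis unfolding closedin_def by (auto simp: cut_def)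
qed

text \<open>If \<open>C\<close> missed the cut, compactness would cover it by finitely many clopen
  sets that are strictly later than \<open>B\<close>. Their union is later than \<open>B\<close> as
  well, and a subset of it cannot come earlier.\<close>

lemma cut_hits_iff:
  assumes R: "clopen_order X R" and B: "B \<in> clopens X" and C: "C \<in> clopens X"
  shows "C \<inter> cut R B \<noteq> {} \<longleftrightarrow> R C B"
proof
  assume "C \<inter> cut R B \<noteq> {}"
  then show "R C B" using C by (auto simp: cut_def)
next
  assume RC: "R C B"
  show "C \<inter> cut R B \<noteq> {}"
  proof
    assume empty: "C \<inter> cut R B = {}"
    let ?U = "{D \<in> clopens X. \<not> R D B}"
    have "compactin X C" using C compact by (auto simp: clopens_def closedin_compact_space)
    moreover have "C \<subseteq> \<Union>?U"
      using empty clopen_subset[OF C] by (fastforce simp: cut_def)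
    moreover have "\<forall>D\<in>?U. openin X D" by (auto simp: clopens_def)
    ultimately obtain \<D> where D: "finite \<D>" "\<D> \<subseteq> ?U" "C \<subseteq> \<Union>\<D>"
      unfolding compactin_def by meson
    have ne: "\<D> \<noteq> {}" using D(3) C by (auto simp: clopens_def)
    have "\<Union>\<D> \<in> clopens X \<and> \<not> R (\<Union>\<D>) B"
      using clopen_order_Union[OF R D(1) ne _ B] D(2) by blast
    then show False using clopen_order_mono[OF R C _ B D(3) RC] by blast
  qed
qed

lemma cut_in_order_chain:
  assumes R: "clopen_order X R" and B: "B \<in> clopens X"
  shows "cut R B \<in> order_chain X R"
proof -
  have "cut R B \<noteq> {}" using cut_hits_iff[OF R B B] clopen_order_refl[OF R B] by blast
  then have "cut R B \<in> hyp X" by (simp add: hyp_def closedin_cut)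
  moreover have "cut R B \<inter> A \<noteq> {}"
    if "A \<in> clopens X" "C \<in> clopens X" "R A C" "cut R B \<inter> C \<noteq> {}" for A C
    using cut_hits_iff[OF R B] that clopen_order_trans[OF R that(1,2) B] by (metis Int_commute)
  ultimately show ?thesis by (simp add: order_chain_def)
qed

text \<open>The cut at \<open>B\<close> is the test set: it hits \<open>B\<close>, so it must hit
  \<open>A\<close>, and it hits only sets that are no later than \<open>B\<close>.\<close>

lemma chain_order_order_chain:
  assumes R: "clopen_order X R" and A: "A \<in> clopens X" and B: "B \<in> clopens X"
  shows "chain_order (order_chain X R) A B \<longleftrightarrow> R A B"
proof
  assume "chain_order (order_chain X R) A B"
  then show "R A B"
    using cut_in_order_chain[OF R B] cut_hits_iff[OF R B A] cut_hits_iff[OF R B B]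
      clopen_order_refl[OF R B] by (auto simp: chain_order_def Int_commute)
qed (use A B in \<open>auto simp: chain_order_def order_chain_def\<close>)

lemma order_chain_maxchain:
  assumes R: "clopen_order X R"
  shows "subset.maxchain (hyp X) (order_chain X R)"
  unfolding subset.maxchain_def
proof (intro conjI notI)
  show "subset.chain (hyp X) (order_chain X R)"
    unfolding subset_chain_def
  proof (intro conjI ballI)
    fix K K' assume K: "K \<in> order_chain X R" "K' \<in> order_chain X R"
    show "K \<subseteq> K' \<or> K' \<subseteq> K"
    proof (rule ccontr)
      assume "\<not> ?thesis"
      then obtain x y where xy: "x \<in> K" "x \<notin> K'" "y \<in> K'" "y \<notin> K" by auto
      have clo: "closedin X K" "closedin X K'" using K by (auto simp: order_chain_def hyp_def)
      obtain A where A: "A \<in> clopens X" "x \<in> A" "A \<inter> K' = {}"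
        using clopen_miss_closed[OF clo(2)] xy clo closedin_subset by blast
      obtain B where B: "B \<in> clopens X" "y \<in> B" "B \<inter> K = {}"
        using clopen_miss_closed[OF clo(1)] xy clo closedin_subset by blast
      have "K \<inter> A \<noteq> {}" "K' \<inter> B \<noteq> {}" "K' \<inter> A = {}" "K \<inter> B = {}"
        using A B xy by auto
      then show False
        using K clopen_order_total[OF R A(1) B(1)] A(1) B(1) unfolding order_chain_def by blast
    qed
  qed (auto simp: order_chain_def)
next
  assume "\<exists>S. subset.chain (hyp X) S \<and> order_chain X R \<subset> S"
  then obtain S K where S: "subset.chain (hyp X) S" "order_chain X R \<subseteq> S"
    and K: "K \<in> S" "K \<notin> order_chain X R" by blast
  have hyp: "K \<in> hyp X" using S(1) K(1) by (auto simp: subset_chain_def)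
  obtain A B where AB: "A \<in> clopens X" "B \<in> clopens X" "R A B" "K \<inter> B \<noteq> {}" "K \<inter> A = {}"
    using K(2) hyp by (auto simp: order_chain_def)
  \<comment> \<open>With \<open>B - A\<close> in place of \<open>B\<close> the two sets are disjoint
    and \<open>A\<close> is strictly first. Since \<open>cut R A\<close> hits \<open>A\<close> and
    \<open>K\<close> does not, comparability puts \<open>K\<close> inside \<open>cut R A\<close>,
    which then hits the later set \<open>B - A\<close>.\<close>
  then have ne: "K \<inter> (B - A) \<noteq> {}" by blast
  then have BA: "B - A \<in> clopens X" using AB clopen_Diff by blast
  have "R B (B - A)" using clopen_order_superset[OF R BA AB(2)] by blast
  then have "R A (B - A)" using clopen_order_trans[OF R AB(1,2) BA AB(3)] by blast
  then have not: "\<not> R (B - A) A" using clopen_order_disjoint[OF R AB(1) BA] by blast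
  have "cut R A \<in> S" using cut_in_order_chain[OF R AB(1)] S(2) by blast
  then have "K \<subseteq> cut R A \<or> cut R A \<subseteq> K" using S(1) K(1) by (auto simp: subset_chain_def)
  moreover have "A \<inter> cut R A \<noteq> {}"
    using cut_hits_iff[OF R AB(1,1)] clopen_order_refl[OF R AB(1)] by blast
  ultimately have "(B - A) \<inter> cut R A \<noteq> {}" using AB(5) ne by blast
  then show False using cut_hits_iff[OF R AB(1) BA] not by blast
qed

lemma maxchain_mem:
  assumes "subset.maxchain (hyp X) c" "K \<in> hyp X" "\<And>F. F \<in> c \<Longrightarrow> F \<subseteq> K \<or> K \<subseteq> F"
  shows "K \<in> c"
proof (rule ccontr)
  assume "K \<notin> c"
  then have "c \<subset> insert K c" by blast
  moreover have "subset.chain (hyp X) (insert K c)"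
    using assms unfolding subset.maxchain_def subset_chain_def by auto
  ultimately show False using assms(1) unfolding subset.maxchain_def by blast
qed

text \<open>Totality and the union rule come from linearity of \<open>c\<close>; maximality and
  compactness enter through the axiom on disjoint sets.\<close>

lemma clopen_order_chain_order:
  assumes c: "subset.maxchain (hyp X) c"
  shows "clopen_order X (chain_order c)"
proof -
  have lin: "F \<subseteq> F' \<or> F' \<subseteq> F" if "F \<in> c" "F' \<in> c" for F F'
    using c that unfolding subset.maxchain_def subset_chain_def by blast
  have hyp: "F \<in> hyp X" if "F \<in> c" for F
    using c that unfolding subset.maxchain_def subset_chain_def by blast
  have total: "chain_order c A B \<or> chain_order c B A" for A B
  proof (rule ccontr)
    assume "\<not> ?thesis"
    then obtain F F' where F: "F \<in> c" "F \<inter> B \<noteq> {}" "F \<inter> A = {}"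
      and F': "F' \<in> c" "F' \<inter> A \<noteq> {}" "F' \<inter> B = {}"
      unfolding chain_order_def by metis
    then show False using lin[OF F(1) F'(1)] by auto
  qed
  have union: "chain_order c (A \<union> B) C \<longleftrightarrow> chain_order c A C \<or> chain_order c B C" for A B C
  proof
    assume AB: "chain_order c (A \<union> B) C"
    show "chain_order c A C \<or> chain_order c B C"
    proof (rule ccontr)
      assume "\<not> ?thesis"
      then obtain F F' where F: "F \<in> c" "F \<inter> C \<noteq> {}" "F \<inter> A = {}"
        and F': "F' \<in> c" "F' \<inter> C \<noteq> {}" "F' \<inter> B = {}"
        unfolding chain_order_def by metis
      have "F \<inter> (A \<union> B) \<noteq> {}" "F' \<inter> (A \<union> B) \<noteq> {}"
        using AB F F' unfolding chain_order_def by blast+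
      then show False using lin[OF F(1) F'(1)] F(3) F'(3) by auto
    qed
  qed (auto simp: chain_order_def)
  have trans: "chain_order c A B \<Longrightarrow> chain_order c B C \<Longrightarrow> chain_order c A C" for A B C
    unfolding chain_order_def by blast
  have disjoint: False
    if A: "A \<in> clopens X" and B: "B \<in> clopens X" and "A \<inter> B = {}"
      and AB: "chain_order c A B" and BA: "chain_order c B A" for A B
  proof -
    have hit: "F \<inter> A \<noteq> {} \<longleftrightarrow> F \<inter> B \<noteq> {}" if "F \<in> c" for F
      using AB BA that unfolding chain_order_def by metis
    txt \<open>The smallest member \<open>T\<close> of \<open>c\<close> that hits \<open>A\<close> also hits \<open>B\<close>; then \<open>T - B\<close> is comparable
      with all of \<open>c\<close>, hence in \<open>c\<close>, and it hits \<open>A\<close> but not \<open>B\<close>.\<close>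
    define E where "E = {F \<in> c. F \<inter> A \<noteq> {}}"
    define T where "T = topspace X \<inter> \<Inter>E"
    have "topspace X \<in> c"
    proof (rule maxchain_mem[OF c])
      show "topspace X \<in> hyp X" using nonempty by (simp add: hyp_def)
    qed (use hyp closedin_subset in \<open>auto simp: hyp_def\<close>)
    then have XE: "topspace X \<in> E"
      using clopen_subset[OF A] A by (auto simp: E_def clopens_def)
    have closed_E: "closedin X F" if "F \<in> E" for F using hyp that by (auto simp: E_def hyp_def)
    have meet: "T \<inter> D \<noteq> {}"
      if D: "closedin X D" "\<And>F. F \<in> E \<Longrightarrow> F \<inter> D \<noteq> {}" for D
    proof -
      have "\<Inter>((\<lambda>F. F \<inter> D) ` E) \<noteq> {}"
      proof -
        have fip: "\<Inter>\<F> \<noteq> {}" if F: "finite \<F>" "\<F> \<subseteq> (\<lambda>F. F \<inter> D) ` E" for \<F>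
        proof (cases "\<F> = {}")
          case False
          obtain \<G> where G: "finite \<G>" "\<G> \<subseteq> E" "\<F> = (\<lambda>F. F \<inter> D) ` \<G>"
            using finite_subset_image[OF F] by blast
          have "\<G> \<noteq> {}" using False G by auto
          \<comment> \<open>A finite nonempty subfamily of a chain contains its own intersection,
            which reduces finite intersections to single members.\<close>
          have "\<Inter>\<G> \<in> \<G>"
            using G(1) \<open>\<G> \<noteq> {}\<close> G(2)
          proof (induction rule: finite_ne_induct)
            case (insert F \<G>)
            then have "F \<subseteq> \<Inter>\<G> \<or> \<Inter>\<G> \<subseteq> F" using lin by (auto simp: E_def)
            then show ?case using insert by (auto simp: Int_absorb1 Int_absorb2)
          qed auto
          then have "\<Inter>\<G> \<inter> D \<noteq> {}" using D(2) G(2) by blast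
          then show ?thesis using G(3) \<open>\<G> \<noteq> {}\<close> by auto
        qed auto
        have "\<forall>C\<in>(\<lambda>F. F \<inter> D) ` E. closedin X C" using D(1) closed_E by auto
        then show ?thesis using compact fip unfolding compact_space_fip by blast
      qed
      then obtain x where "\<And>F. F \<in> E \<Longrightarrow> x \<in> F \<inter> D" by (metis INT_E ex_in_conv)
      then have "x \<in> T \<inter> D" using XE by (auto simp: T_def)
      then show ?thesis by blast
    qed
    have TA: "T \<inter> A \<noteq> {}" using A by (intro meet) (auto simp: clopens_def E_def)
    have TB: "T \<inter> B \<noteq> {}"
      using B hit by (intro meet) (auto simp: clopens_def E_def)
    have closed_T: "closedin X T"
      unfolding T_def using closed_E XE by (intro closedin_Int closedin_Inter) auto
    define K where "K = T - B"
    have "K \<noteq> {}" using TA \<open>A \<inter> B = {}\<close> by (auto simp: K_def)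
    then have "K \<in> hyp X"
      using closed_T B by (auto simp: hyp_def K_def clopens_def intro: closedin_diff)
    have "K \<in> c"
    proof (rule maxchain_mem[OF c \<open>K \<in> hyp X\<close>])
      fix F assume F: "F \<in> c"
      show "F \<subseteq> K \<or> K \<subseteq> F"
      proof (cases "F \<inter> A = {}")
        case True
        then have "F \<inter> B = {}" using hit[OF F] by blast
        have "F \<subseteq> G" if "G \<in> E" for G
          using lin[OF F, of G] True that by (auto simp: E_def)
        then have "F \<subseteq> T" using hyp[OF F] closedin_subset by (auto simp: T_def hyp_def)
        then show ?thesis using \<open>F \<inter> B = {}\<close> by (auto simp: K_def)
      next
        case False
        then show ?thesis using F by (auto simp: K_def T_def E_def)
      qed
    qed
    moreover have "K \<inter> A \<noteq> {}" using TA \<open>A \<inter> B = {}\<close> by (auto simp: K_def)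
    moreover have "K \<inter> B = {}" by (auto simp: K_def)
    ultimately show False using hit[of K] by simp
  qed
  show ?thesis
    unfolding clopen_order_def
    by (intro conjI ballI impI total union) (use trans disjoint in blast)+
qed

section \<open>Vietoris topologies and the space of maximal chains\<close>

lemma topspace_vietoris: "topspace (vietoris Y) = hyp Y"
proof -
  have "hyp Y = {F \<in> hyp Y. F \<subseteq> topspace Y}"
    using closedin_subset by (auto simp: hyp_def)
  then have "hyp Y \<in> {{F \<in> hyp Y. F \<subseteq> U} |U. openin Y U}" by blast
  then show ?thesis
    unfolding vietoris_def topology_generated_by_topspace
    by (intro equalityI Union_least Union_upper UnI1) auto
qed

lemma openin_vietoris_subset: "openin Y U \<Longrightarrow> openin (vietoris Y) {F \<in> hyp Y. F \<subseteq> U}"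
  and openin_vietoris_hit: "openin Y U \<Longrightarrow> openin (vietoris Y) {F \<in> hyp Y. F \<inter> U \<noteq> {}}"
  unfolding vietoris_def by (rule topology_generated_by_Basis, blast)+

text \<open>Missing a clopen set means lying in its open complement, so hitting and missing are both
  open conditions.\<close>

lemma openin_vietoris_order:
  assumes A: "A \<in> clopens X" and B: "B \<in> clopens X"
  defines "W \<equiv> {F \<in> hyp X. F \<inter> B \<noteq> {} \<longrightarrow> F \<inter> A \<noteq> {}}"
  shows "openin (vietoris X) W" and "openin (vietoris X) (hyp X - W)"
proof -
  have eq: "W = {F \<in> hyp X. F \<subseteq> topspace X - B} \<union> {F \<in> hyp X. F \<inter> A \<noteq> {}}"
    "hyp X - W = {F \<in> hyp X. F \<inter> B \<noteq> {}} \<inter> {F \<in> hyp X. F \<subseteq> topspace X - A}"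
    using closedin_subset by (fastforce simp: W_def hyp_def)+
  have "openin X A" "openin X B" "openin X (topspace X - A)" "openin X (topspace X - B)"
    using A B by (auto simp: clopens_def)
  then show "openin (vietoris X) W" "openin (vietoris X) (hyp X - W)"
    unfolding eq(2) unfolding eq(1)
    by (blast intro: openin_Un openin_Int openin_vietoris_subset openin_vietoris_hit)+
qed

lemma topspace_Phi: "topspace (Phi_space X) = {c. subset.maxchain (hyp X) c \<and> c \<in> hyp (vietoris X)}"
  by (auto simp: Phi_space_def topspace_vietoris)

text \<open>Points of \<open>Phi_space X\<close> must be closed in the hyperspace;
  \<open>order_chain X R\<close> is, since each violated comparison is an open condition.\<close>

lemma order_chain_in_Phi:
  assumes R: "clopen_order X R"
  shows "order_chain X R \<in> topspace (Phi_space X)"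
proof -
  have top: "topspace X \<in> clopens X" using nonempty by (simp add: clopens_def)
  have "hyp X - order_chain X R = (\<Union>(A, B) \<in> {(A, B). A \<in> clopens X \<and> B \<in> clopens X \<and> R A B}.
      hyp X - {F \<in> hyp X. F \<inter> B \<noteq> {} \<longrightarrow> F \<inter> A \<noteq> {}})"
    by (auto simp: order_chain_def)
  moreover have "openin (vietoris X) \<dots>"
    using openin_vietoris_order(2) by (intro openin_Union) auto
  ultimately have "closedin (vietoris X) (order_chain X R)"
    unfolding closedin_def topspace_vietoris by (auto simp: order_chain_def)
  moreover have "order_chain X R \<noteq> {}" using cut_in_order_chain[OF R top] by blast
  ultimately show ?thesis
    using order_chain_maxchain[OF R] by (simp add: topspace_Phi) (simp add: hyp_def)
qed

text \<open>The source of continuity: a comparison says that the chain lies in the clopen set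
  \<open>W\<close>, its negation that the chain hits the complement, and the outer Vietoris topology
  makes both open.\<close>

lemma openin_Phi_chain_order:
  assumes A: "A \<in> clopens X" and B: "B \<in> clopens X"
  shows "openin (Phi_space X) {c \<in> topspace (Phi_space X). chain_order c A B}"
    and "openin (Phi_space X) {c \<in> topspace (Phi_space X). \<not> chain_order c A B}"
proof -
  define W where "W = {F \<in> hyp X. F \<inter> B \<noteq> {} \<longrightarrow> F \<inter> A \<noteq> {}}"
  have sub: "c \<subseteq> hyp X" if "c \<in> topspace (Phi_space X)" for c
    using that unfolding topspace_Phi subset.maxchain_def subset_chain_def by blast
  have order_iff: "chain_order c A B \<longleftrightarrow> c \<subseteq> W" "\<not> chain_order c A B \<longleftrightarrow> c \<inter> (hyp X - W) \<noteq> {}"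
    if "c \<in> topspace (Phi_space X)" for c
    using sub[OF that] unfolding W_def chain_order_def by blast+
  have "{c \<in> topspace (Phi_space X). chain_order c A B} = {c \<in> topspace (Phi_space X). c \<subseteq> W}"
    using order_iff(1) by blast
  also have "\<dots> = {c \<in> hyp (vietoris X). c \<subseteq> W} \<inter> {c. subset.maxchain (hyp X) c}"
    by (auto simp: topspace_Phi)
  finally have eq1: "{c \<in> topspace (Phi_space X). chain_order c A B} = \<dots>" .
  have "{c \<in> topspace (Phi_space X). \<not> chain_order c A B}
      = {c \<in> topspace (Phi_space X). c \<inter> (hyp X - W) \<noteq> {}}"
    using order_iff(2) by blast
  also have "\<dots> = {c \<in> hyp (vietoris X). c \<inter> (hyp X - W) \<noteq> {}} \<inter> {c. subset.maxchain (hyp X) c}"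
    by (auto simp: topspace_Phi)
  finally have eq2: "{c \<in> topspace (Phi_space X). \<not> chain_order c A B} = \<dots>" .
  show "openin (Phi_space X) {c \<in> topspace (Phi_space X). chain_order c A B}"
    "openin (Phi_space X) {c \<in> topspace (Phi_space X). \<not> chain_order c A B}"
    unfolding eq1 eq2 unfolding Phi_space_def W_def
    by (rule openin_subtopology_Int openin_vietoris_subset openin_vietoris_hit
        openin_vietoris_order[OF A B])+
qed

end

section \<open>Ordered partitions and their order types\<close>

definition clopen_partition :: "'a topology \<Rightarrow> 'a set set \<Rightarrow> bool" where
  "clopen_partition X P \<longleftrightarrow> finite P \<and> P \<subseteq> clopens X \<and> pairwise disjnt P \<and> \<Union>P = topspace X"

definition coarsen :: "nat list \<Rightarrow> 'a set list \<Rightarrow> nat \<Rightarrow> 'a set list" where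
  "coarsen s \<gamma> k = map (\<lambda>i. \<Union>l\<in>{l. l < length \<gamma> \<and> s ! l = i}. \<gamma> ! l) [0..<k]"

definition first_pos :: "nat list \<Rightarrow> nat \<Rightarrow> nat" where
  "first_pos s i = (LEAST l. l < length s \<and> s ! l = i)"

definition first_pos_order :: "nat \<Rightarrow> nat list \<Rightarrow> (nat \<times> nat) set" where
  "first_pos_order k s = {(i, j). i < k \<and> j < k \<and> first_pos s i \<le> first_pos s j}"

definition order_type :: "('a set \<Rightarrow> 'a set \<Rightarrow> bool) \<Rightarrow> 'a set list \<Rightarrow> (nat \<times> nat) set" where
  "order_type R \<beta> = {(i, j). i < length \<beta> \<and> j < length \<beta> \<and> R (\<beta> ! i) (\<beta> ! j)}"

lemma length_coarsen [simp]: "length (coarsen s \<gamma> k) = k"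
  by (simp add: coarsen_def)

lemma nth_coarsen: "i < k \<Longrightarrow> coarsen s \<gamma> k ! i = (\<Union>l\<in>{l. l < length \<gamma> \<and> s ! l = i}. \<gamma> ! l)"
  by (simp add: coarsen_def)

lemma map_image_coarsen: "map (\<lambda>B. f ` B) (coarsen s \<gamma> k) = coarsen s (map (\<lambda>B. f ` B) \<gamma>) k"
  by (rule nth_equalityI) (simp_all add: nth_coarsen image_UN)

text \<open>The counterpart of word composition: coarsening twice composes the labellings.\<close>

lemma coarsen_coarsen:
  assumes "length w = length \<gamma>" "set w \<subseteq> {..<m}"
  shows "coarsen s (coarsen w \<gamma> m) k = coarsen (map (\<lambda>c. s ! c) w) \<gamma> k"
proof (rule nth_equalityI)
  fix i assume "i < length (coarsen s (coarsen w \<gamma> m) k)"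
  then have i: "i < k" by simp
  have m: "w ! l < m" if "l < length \<gamma>" for l
    using subsetD[OF assms(2) nth_mem[of l w]] assms(1) that by simp
  show "coarsen s (coarsen w \<gamma> m) k ! i = coarsen (map (\<lambda>c. s ! c) w) \<gamma> k ! i"
  proof (intro equalityI subsetI)
    fix x assume "x \<in> coarsen s (coarsen w \<gamma> m) k ! i"
    then obtain c where "c < m" "s ! c = i" "x \<in> coarsen w \<gamma> m ! c"
      using i by (auto simp: nth_coarsen)
    then show "x \<in> coarsen (map (\<lambda>c. s ! c) w) \<gamma> k ! i"
      using i assms(1) by (fastforce simp: nth_coarsen)
  next
    fix x assume "x \<in> coarsen (map (\<lambda>c. s ! c) w) \<gamma> k ! i"
    then obtain l where l: "l < length \<gamma>" "s ! (w ! l) = i" "x \<in> \<gamma> ! l"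
      using i assms(1) by (auto simp: nth_coarsen)
    then have "x \<in> coarsen w \<gamma> m ! (w ! l)" using m by (auto simp: nth_coarsen)
    moreover have "coarsen w \<gamma> m ! (w ! l) \<subseteq> coarsen s (coarsen w \<gamma> m) k ! i"
      using l m[of l] unfolding nth_coarsen[OF i] length_coarsen by (intro UN_upper) simp
    ultimately show "x \<in> coarsen s (coarsen w \<gamma> m) k ! i" by blast
  qed
qed simp

lemma first_pos:
  assumes "i \<in> set s"
  shows "first_pos s i < length s" "s ! first_pos s i = i"
proof -
  have "\<exists>l. l < length s \<and> s ! l = i" using assms by (simp add: in_set_conv_nth)
  then have "first_pos s i < length s \<and> s ! first_pos s i = i"
    unfolding first_pos_def by (rule LeastI_ex)
  then show "first_pos s i < length s" "s ! first_pos s i = i" by auto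
qed

lemma first_pos_le: "l < length s \<Longrightarrow> first_pos s (s ! l) \<le> l"
  unfolding first_pos_def by (rule Least_le) simp

text \<open>Numbering the letters of \<open>s\<close> by first occurrence makes \<open>s\<close> rigid, and the renumbering is determined by
  \<open>first_pos_order k s\<close> alone.\<close>

definition rank :: "(nat \<times> nat) set \<Rightarrow> nat \<Rightarrow> nat" where
  "rank T j = card {i. (i, j) \<in> T \<and> i \<noteq> j}"

lemma rigid_rank:
  assumes s: "set s = {..<k}"
  defines "T \<equiv> first_pos_order k s"
  shows "rigid 0 k (map (rank T) s)"
    and "map (inv_into {..<k} (rank T)) (map (rank T) s) = s"
proof -
  let ?f = "first_pos s"
  have f: "?f i < length s" "s ! ?f i = i" if "i < k" for i using first_pos[of i s] that s by simp_all
  have inj_f: "inj_on ?f {..<k}" by (rule inj_on_inverseI[of _ "\<lambda>l. s ! l"]) (simp add: f(2))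
  have rank_eq: "rank T j = card {i. i < k \<and> ?f i < ?f j}" if "j < k" for j
  proof -
    have "?f i = ?f j \<longleftrightarrow> i = j" if "i < k" for i
      using inj_on_eq_iff[OF inj_f, of i j] that \<open>j < k\<close> by simp
    then have "{i. (i, j) \<in> T \<and> i \<noteq> j} = {i. i < k \<and> ?f i < ?f j}"
      using that by (auto simp: T_def first_pos_order_def order_less_le)
    then show ?thesis by (simp add: rank_def)
  qed
  have mono: "rank T i < rank T j" if "i < k" "j < k" "?f i < ?f j" for i j
    unfolding rank_eq[OF that(1)] rank_eq[OF that(2)]
    using that by (intro psubset_card_mono psubsetI) auto
  then have less_iff: "rank T i < rank T j \<longleftrightarrow> ?f i < ?f j" if "i < k" "j < k" for i j
    using that mono[of i j] mono[of j i] f(2)[of i] f(2)[of j]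
    by (metis linorder_neqE_nat not_less_iff_gr_or_eq)
  have inj: "inj_on (rank T) {..<k}"
  proof (rule inj_onI)
    fix i j assume ij: "i \<in> {..<k}" "j \<in> {..<k}" "rank T i = rank T j"
    then have "?f i = ?f j" using less_iff[of i j] less_iff[of j i] by simp
    then show "i = j" using inj_onD[OF inj_f _ ij(1,2)] by simp
  qed
  have "rank T ` {..<k} \<subseteq> {..<k}"
  proof (intro subsetI, elim imageE)
    fix x j assume j: "x = rank T j" "j \<in> {..<k}"
    have "j \<notin> {i. i < k \<and> ?f i < ?f j}" by simp
    then have "{i. i < k \<and> ?f i < ?f j} \<subset> {..<k}" using j(2) by blast
    then have "card {i. i < k \<and> ?f i < ?f j} < card {..<k}"
      by (rule psubset_card_mono[OF finite_lessThan])
    then show "x \<in> {..<k}" using j rank_eq[of j] by simp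
  qed
  then have image: "rank T ` {..<k} = {..<k}" using inj by (simp add: endo_inj_surj)
  show "rigid 0 k (map (rank T) s)"
  proof (rule rigidI)
    fix l i assume l: "l < length (map (rank T) s)" "i < map (rank T) s ! l"
    have sl: "s ! l < k" using nth_mem[of l s] l s by auto
    have "rank T (s ! l) < k" using image sl by blast
    then have il: "i \<in> {..<k}" using l by simp
    then obtain j where j: "j < k" "rank T j = i"
      using il by (metis image imageE lessThan_iff)
    then have "?f j < ?f (s ! l)" using less_iff[OF j(1) sl] l by simp
    also have "\<dots> \<le> l" using first_pos_le l by simp
    finally show "\<exists>l'<l. map (rank T) s ! l' = i"
      using f[OF j(1)] j(2) by (intro exI[of _ "?f j"]) simp
  qed (use image s in auto)
  show "map (inv_into {..<k} (rank T)) (map (rank T) s) = s"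
    unfolding map_map comp_def by (rule map_idI) (simp add: s inj)
qed

text \<open>In a list sorted by \<open>R\<close>, a block is represented by its first piece, so
  blocks compare as their first positions do.\<close>

lemma order_type_coarsen:
  assumes R: "clopen_order X R" and \<gamma>: "set \<gamma> \<subseteq> clopens X" "length s = length \<gamma>" "set s = {..<k}"
    and sorted: "\<And>l l'. l < length \<gamma> \<Longrightarrow> l' < length \<gamma> \<Longrightarrow> R (\<gamma> ! l) (\<gamma> ! l') \<longleftrightarrow> l \<le> l'"
  shows "order_type R (coarsen s \<gamma> k) = first_pos_order k s"
proof -
  have "R (coarsen s \<gamma> k ! i) (coarsen s \<gamma> k ! j) \<longleftrightarrow> first_pos s i \<le> first_pos s j"
    if ij: "i < k" "j < k" for i j
  proof -
    define L where "L i = {l. l < length s \<and> s ! l = i}" for i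
    define \<D> where "\<D> i = (\<lambda>l. \<gamma> ! l) ` L i" for i
    have D: "finite (\<D> i)" "\<D> i \<noteq> {}" "\<D> i \<subseteq> clopens X" if "i < k" for i
      using \<gamma> first_pos[of i s] that by (auto simp: \<D>_def L_def)
    have Dj: "\<Union>(\<D> j) \<in> clopens X"
      using clopen_order_Union[OF R D[OF ij(2)]] D[OF ij(2)] by blast
    have nth: "coarsen s \<gamma> k ! i = \<Union>(\<D> i)" if "i < k" for i
      using \<gamma>(2) unfolding nth_coarsen[OF that] \<D>_def L_def by (auto simp: image_Collect)
    have "R (coarsen s \<gamma> k ! i) (coarsen s \<gamma> k ! j) \<longleftrightarrow> (\<exists>A\<in>\<D> i. R A (\<Union>(\<D> j)))"
      using clopen_order_Union[OF R D[OF ij(1)] Dj] ij nth by simp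
    also have "\<dots> \<longleftrightarrow> (\<exists>A\<in>\<D> i. \<forall>B\<in>\<D> j. R A B)"
      using clopen_order_Union[OF R D[OF ij(2)]] D(3)[OF ij(1)] by blast
    also have "\<dots> \<longleftrightarrow> (\<exists>l\<in>L i. \<forall>l'\<in>L j. R (\<gamma> ! l) (\<gamma> ! l'))"
      by (simp add: \<D>_def)
    also have "\<dots> \<longleftrightarrow> (\<exists>l\<in>L i. \<forall>l'\<in>L j. l \<le> l')"
      using sorted \<gamma>(2) by (intro bex_cong ball_cong refl) (simp add: L_def)
    also have "\<dots> \<longleftrightarrow> (\<exists>l<length s. s ! l = i \<and> (\<forall>l'<length s. s ! l' = j \<longrightarrow> l \<le> l'))"
      by (auto simp: L_def)
    also have "\<dots> \<longleftrightarrow> first_pos s i \<le> first_pos s j"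
    proof
      assume "\<exists>l<length s. s ! l = i \<and> (\<forall>l'<length s. s ! l' = j \<longrightarrow> l \<le> l')"
      then obtain l where l: "l < length s" "s ! l = i" "\<And>l'. l' < length s \<Longrightarrow> s ! l' = j \<Longrightarrow> l \<le> l'"
        by blast
      have "first_pos s i \<le> l" using first_pos_le l by blast
      also have "l \<le> first_pos s j" using l(3) first_pos[of j s] ij \<gamma>(3) by simp
      finally show "first_pos s i \<le> first_pos s j" .
    next
      assume "first_pos s i \<le> first_pos s j"
      then have "\<forall>l'<length s. s ! l' = j \<longrightarrow> first_pos s i \<le> l'"
        using first_pos_le order_trans by blast
      then show "\<exists>l<length s. s ! l = i \<and> (\<forall>l'<length s. s ! l' = j \<longrightarrow> l \<le> l')"
        using first_pos[of i s] ij \<gamma>(3) by (intro exI[of _ "first_pos s i"]) simp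
    qed
    finally show ?thesis .
  qed
  then show ?thesis by (auto simp: order_type_def first_pos_order_def)
qed

lemma Dk_iff_clopens:
  "\<beta> \<in> Dk X k \<longleftrightarrow> length \<beta> = k \<and> set \<beta> \<subseteq> clopens X \<and>
    (\<forall>i<k. \<forall>j<k. i \<noteq> j \<longrightarrow> \<beta> ! i \<inter> \<beta> ! j = {}) \<and> \<Union>(set \<beta>) = topspace X"
  by (auto simp: Dk_def clopens_def)

lemma coarsen_in_Dk:
  assumes \<gamma>: "\<gamma> \<in> Dk X m" and s: "length s = m" "set s = {..<k}"
  shows "coarsen s \<gamma> k \<in> Dk X k"
proof -
  have \<gamma>': "length \<gamma> = m" "\<And>l. l < m \<Longrightarrow> openin X (\<gamma> ! l) \<and> closedin X (\<gamma> ! l) \<and> \<gamma> ! l \<noteq> {}"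
    "\<And>l l'. l < m \<Longrightarrow> l' < m \<Longrightarrow> l \<noteq> l' \<Longrightarrow> \<gamma> ! l \<inter> \<gamma> ! l' = {}" "\<Union>(set \<gamma>) = topspace X"
    using \<gamma> by (auto simp: Dk_def)
  have nth: "coarsen s \<gamma> k ! i = (\<Union>l\<in>{l. l < m \<and> s ! l = i}. \<gamma> ! l)" if "i < k" for i
    using nth_coarsen[OF that, of s \<gamma>] \<gamma>'(1) by simp
  have clo: "coarsen s \<gamma> k ! i \<in> clopens X" if i: "i < k" for i
  proof -
    have "openin X (coarsen s \<gamma> k ! i)" "closedin X (coarsen s \<gamma> k ! i)"
      unfolding nth[OF i] using \<gamma>'(2) by (auto intro!: openin_Union closedin_Union)
    moreover have "\<gamma> ! first_pos s i \<subseteq> coarsen s \<gamma> k ! i" "\<gamma> ! first_pos s i \<noteq> {}"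
      unfolding nth[OF i] using first_pos[of i s] s i \<gamma>'(2) by auto
    ultimately show ?thesis by (auto simp: clopens_def)
  qed
  have disj: "coarsen s \<gamma> k ! i \<inter> coarsen s \<gamma> k ! j = {}" if ij: "i < k" "j < k" "i \<noteq> j" for i j
  proof (rule ccontr)
    assume "\<not> ?thesis"
    then obtain l l' where "\<gamma> ! l \<inter> \<gamma> ! l' \<noteq> {}" "l < m" "l' < m" "s ! l = i" "s ! l' = j"
      unfolding nth[OF ij(1)] nth[OF ij(2)] by blast
    then show False using \<gamma>'(3)[of l l'] ij(3) by auto
  qed
  have "\<Union>(set (coarsen s \<gamma> k)) = (\<Union>i<k. coarsen s \<gamma> k ! i)"
    by (auto simp: set_conv_nth)
  also have "\<dots> = \<Union>(set \<gamma>)"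
  proof (intro equalityI subsetI)
    fix x assume "x \<in> \<Union>(set \<gamma>)"
    then obtain l where l: "l < m" "x \<in> \<gamma> ! l" using \<gamma>'(1) by (auto simp: in_set_conv_nth)
    then have "s ! l < k" using nth_mem[of l s] s by auto
    then show "x \<in> (\<Union>i<k. coarsen s \<gamma> k ! i)" using l by (auto simp: nth)
  qed (use \<gamma>'(1) in \<open>auto simp: nth\<close>)
  finally show ?thesis using clo disj \<gamma>'(4) unfolding Dk_iff_clopens
    by (auto simp: in_set_conv_nth)
qed

section \<open>Listing a clopen partition along an order\<close>

lemma sorted_enumeration:
  assumes "finite P" "\<And>x y. x \<in> P \<Longrightarrow> y \<in> P \<Longrightarrow> R x y \<or> R y x"
    "\<And>x y z. x \<in> P \<Longrightarrow> y \<in> P \<Longrightarrow> z \<in> P \<Longrightarrow> R x y \<Longrightarrow> R y z \<Longrightarrow> R x z"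
  shows "\<exists>xs. distinct xs \<and> set xs = P \<and> sorted_wrt R xs"
  using assms
proof (induction rule: finite_psubset_induct)
  case (psubset P)
  show ?case
  proof (cases "P = {}")
    case False
    have "\<exists>m\<in>Q. \<forall>x\<in>Q. R m x" if "finite Q" "Q \<noteq> {}" "Q \<subseteq> P" for Q
      using that
    proof (induction rule: finite_ne_induct)
      case (singleton x)
      then show ?case using psubset.prems(1) by blast
    next
      case (insert x Q)
      then obtain m where m: "m \<in> Q" "\<forall>x\<in>Q. R m x" by auto
      show ?case
      proof (cases "R m x")
        case False
        then have "R x m" "R x x" using psubset.prems(1) insert.prems m(1) by blast+
        moreover have "R x y" if "y \<in> Q" for y
          using psubset.prems(2)[of x m y] \<open>R x m\<close> m that insert.prems by blast
        ultimately show ?thesis by blast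
      qed (use m in auto)
    qed
    then obtain m where m: "m \<in> P" "\<forall>x\<in>P. R m x" using psubset.hyps False by blast
    obtain xs where "distinct xs \<and> set xs = P - {m} \<and> sorted_wrt R xs"
      using psubset.IH[of "P - {m}"] psubset.prems m(1) by blast
    then show ?thesis using m by (intro exI[of _ "m # xs"]) auto
  qed auto
qed

lemma distinct_enumeration_in_Dk:
  assumes "distinct \<gamma>" "clopen_partition X (set \<gamma>)"
  shows "\<gamma> \<in> Dk X (length \<gamma>)"
proof -
  have "\<gamma> ! i \<inter> \<gamma> ! j = {}" if "i < length \<gamma>" "j < length \<gamma>" "i \<noteq> j" for i j
    using assms that unfolding clopen_partition_def pairwise_def disjnt_def
    by (metis nth_eq_iff_index_eq nth_mem)
  then show ?thesis
    using assms(2) unfolding Dk_iff_clopens clopen_partition_def by auto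
qed

text \<open>Different pieces are disjoint and hence never tied, so the sorted list is strictly
  sorted.\<close>

lemma clopen_partition_enumeration:
  assumes R: "clopen_order X R" and P: "clopen_partition X P"
  obtains \<gamma> where "\<gamma> \<in> Dk X (card P)" "set \<gamma> = P"
    "\<And>l l'. l < length \<gamma> \<Longrightarrow> l' < length \<gamma> \<Longrightarrow> R (\<gamma> ! l) (\<gamma> ! l') \<longleftrightarrow> l \<le> l'"
proof -
  have sub: "P \<subseteq> clopens X" and fin: "finite P"
    using P by (auto simp: clopen_partition_def)
  have "R x y \<or> R y x" if "x \<in> P" "y \<in> P" for x y
    using clopen_order_total[OF R, of x y] sub that by blast
  moreover have "R x z" if "x \<in> P" "y \<in> P" "z \<in> P" "R x y" "R y z" for x y z
    using clopen_order_trans[OF R, of x y z] sub that by blast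
  ultimately obtain \<gamma> where \<gamma>: "distinct \<gamma>" "set \<gamma> = P" "sorted_wrt R \<gamma>"
    using sorted_enumeration[OF fin, of R] by blast
  have \<gamma>_Dk: "\<gamma> \<in> Dk X (card P)"
    using distinct_enumeration_in_Dk[OF \<gamma>(1)] P \<gamma>(2) distinct_card[OF \<gamma>(1)] by simp
  then have disj': "\<gamma> ! i \<inter> \<gamma> ! j = {}" if "i < length \<gamma>" "j < length \<gamma>" "i \<noteq> j" for i j
    using that by (auto simp: Dk_def)
  note \<gamma>_Dk
  moreover have "R (\<gamma> ! l) (\<gamma> ! l') \<longleftrightarrow> l \<le> l'" if l: "l < length \<gamma>" "l' < length \<gamma>" for l l'
  proof -
    have mem: "\<gamma> ! l \<in> clopens X" "\<gamma> ! l' \<in> clopens X" using l \<gamma>(2) sub nth_mem by blast+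
    consider "l < l'" | "l = l'" | "l' < l" by linarith
    then show ?thesis
    proof cases
      case 1
      then show ?thesis using \<gamma>(3) l by (simp add: sorted_wrt_iff_nth_less)
    next
      case 2
      then show ?thesis using clopen_order_refl[OF R mem(1)] by simp
    next
      case 3
      then have "R (\<gamma> ! l') (\<gamma> ! l)" using \<gamma>(3) l by (simp add: sorted_wrt_iff_nth_less)
      then show ?thesis
        using clopen_order_disjoint[OF R mem disj'[OF l]] 3 by auto
    qed
  qed
  ultimately show ?thesis using that \<gamma>(2) by blast
qed

section \<open>Patterns\<close>

lemma Dk_nth: "\<beta> \<in> Dk X k \<Longrightarrow> i < k \<Longrightarrow> \<beta> ! i \<in> clopens X"
  unfolding Dk_iff_clopens by (metis nth_mem subsetD)

lemma homeomorphic_image_clopen: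
  assumes "homeomorphic_map X X h" "A \<in> clopens X"
  shows "h ` A \<in> clopens X"
proof -
  have "openin X (h ` A)" "closedin X (h ` A)"
    using homeomorphic_map_openness[OF assms(1) clopen_subset[OF assms(2)]]
      homeomorphic_map_closedness[OF assms(1) clopen_subset[OF assms(2)]] assms(2)
    unfolding clopens_def by blast+
  then show ?thesis using assms(2) by (simp add: clopens_def)
qed

lemma homeomorphic_image_Int:
  assumes "homeomorphic_map X X h" "A \<subseteq> topspace X" "B \<subseteq> topspace X"
  shows "h ` A \<inter> h ` B = h ` (A \<inter> B)"
  using inj_on_image_Int[OF homeomorphic_imp_injective_map[OF assms(1)] assms(2,3)] by simp

lemma homeomorphic_image_Dk:
  assumes h: "homeomorphic_map X X h" and \<beta>: "\<beta> \<in> Dk X k"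
  shows "map (\<lambda>B. h ` B) \<beta> \<in> Dk X k"
proof -
  have \<beta>': "length \<beta> = k" "set \<beta> \<subseteq> clopens X" "\<Union>(set \<beta>) = topspace X"
    "\<And>i j. i < k \<Longrightarrow> j < k \<Longrightarrow> i \<noteq> j \<Longrightarrow> \<beta> ! i \<inter> \<beta> ! j = {}"
    using \<beta> by (auto simp: Dk_iff_clopens)
  have mem: "\<beta> ! i \<in> clopens X" if "i < k" for i
    using that \<beta>'(1,2) nth_mem by blast
  have "h ` (\<beta> ! i) \<inter> h ` (\<beta> ! j) = {}" if "i < k" "j < k" "i \<noteq> j" for i j
    using homeomorphic_image_Int[OF h, of "\<beta> ! i" "\<beta> ! j"] clopen_subset[OF mem] that \<beta>'(4) by simp
  moreover have "\<Union>(set (map (\<lambda>B. h ` B) \<beta>)) = topspace X"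
  proof -
    have "\<Union>(set (map (\<lambda>B. h ` B) \<beta>)) = h ` \<Union>(set \<beta>)" by (simp add: image_Union)
    then show ?thesis unfolding \<beta>'(3) homeomorphic_imp_surjective_map[OF h] .
  qed
  moreover have "set (map (\<lambda>B. h ` B) \<beta>) \<subseteq> clopens X"
    using \<beta>'(2) homeomorphic_image_clopen[OF h] unfolding set_map by blast
  ultimately show ?thesis using \<beta>'(1) by (simp add: Dk_iff_clopens)
qed

lemma homeomorphic_map_inv_into:
  assumes g: "homeomorphic_map X X g"
  shows "homeomorphic_map X X (inv_into (topspace X) g)"
proof -
  obtain g' where g': "homeomorphic_maps X X g g'"
    using g by (auto simp: homeomorphic_map_maps)
  then have "homeomorphic_map X X g'" by (simp add: homeomorphic_maps_map)
  moreover have "g' x = inv_into (topspace X) g x" if "x \<in> topspace X" for x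
  proof -
    have "g' x \<in> topspace X" "g (g' x) = x"
      using g' that by (auto simp: homeomorphic_maps_def continuous_map_def)
    then show ?thesis
      using inv_into_f_f[OF homeomorphic_imp_injective_map[OF g], of "g' x"] by simp
  qed
  ultimately show ?thesis by (rule homeomorphic_map_eq)
qed

lemma clopen_order_image:
  assumes R: "clopen_order X R" and h: "homeomorphic_map X X h"
  shows "clopen_order X (\<lambda>A B. R (h ` A) (h ` B))"
proof -
  have mem: "h ` A \<in> clopens X" if "A \<in> clopens X" for A
    using homeomorphic_image_clopen[OF h that] .
  have disj: "h ` A \<inter> h ` B = {}" if "A \<in> clopens X" "B \<in> clopens X" "A \<inter> B = {}" for A B
    using homeomorphic_image_Int[OF h clopen_subset[OF that(1)] clopen_subset[OF that(2)]] that(3)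
    by simp
  show ?thesis
    unfolding clopen_order_def
  proof (intro conjI ballI impI)
    fix A B assume "A \<in> clopens X" "B \<in> clopens X" "A \<inter> B = {}"
    then show "\<not> (R (h ` A) (h ` B) \<and> R (h ` B) (h ` A))"
      using clopen_order_disjoint[OF R mem mem disj, of A B] by blast
  next
    fix A B assume "A \<in> clopens X" "B \<in> clopens X"
    then show "R (h ` A) (h ` B) \<or> R (h ` B) (h ` A)"
      by (intro clopen_order_total[OF R] mem)
  next
    fix A B C assume "A \<in> clopens X" "B \<in> clopens X" "C \<in> clopens X"
      "R (h ` A) (h ` B)" "R (h ` B) (h ` C)"
    then show "R (h ` A) (h ` C)"
      using clopen_order_trans[OF R mem mem mem, of A B C] by blast
  next
    fix A B C assume "A \<in> clopens X" "B \<in> clopens X" "C \<in> clopens X"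
    then show "R (h ` (A \<union> B)) (h ` C) \<longleftrightarrow> R (h ` A) (h ` C) \<or> R (h ` B) (h ` C)"
      unfolding image_Un by (intro clopen_order_Un[OF R] mem)
  qed
qed

lemma clopen_order_transfer:
  assumes R: "clopen_order X R"
    and eq: "\<And>A B. A \<in> clopens X \<Longrightarrow> B \<in> clopens X \<Longrightarrow> R' A B = R A B"
  shows "clopen_order X R'"
  unfolding clopen_order_def
proof (intro conjI ballI)
  fix A B assume A: "A \<in> clopens X" and B: "B \<in> clopens X"
  show "R' A B \<or> R' B A"
    unfolding eq[OF A B] eq[OF B A] by (rule clopen_order_total[OF R A B])
  show "A \<inter> B = {} \<longrightarrow> \<not> (R' A B \<and> R' B A)"
    unfolding eq[OF A B] eq[OF B A] using clopen_order_disjoint[OF R A B] by blast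
  fix C assume C: "C \<in> clopens X"
  show "R' A B \<longrightarrow> R' B C \<longrightarrow> R' A C"
    unfolding eq[OF A B] eq[OF B C] eq[OF A C] using clopen_order_trans[OF R A B C] by blast
  show "R' (A \<union> B) C \<longleftrightarrow> R' A C \<or> R' B C"
    unfolding eq[OF clopen_Un[OF A B] C] eq[OF A C] eq[OF B C] by (rule clopen_order_Un[OF R A B C])
qed

definition pattern :: "'a topology \<Rightarrow> nat \<Rightarrow> ((nat \<times> nat) set \<Rightarrow> int) \<Rightarrow>
    ('a set \<Rightarrow> 'a set \<Rightarrow> bool) \<Rightarrow> 'a set list \<Rightarrow> int" where
  "pattern X k \<phi> R = restrict (\<lambda>\<beta>. \<phi> (order_type R \<beta>)) (Dk X k)"

lemma pattern_cong:
  assumes "\<And>A B. A \<in> clopens X \<Longrightarrow> B \<in> clopens X \<Longrightarrow> R A B = R' A B"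
  shows "pattern X k \<phi> R = pattern X k \<phi> R'"
proof -
  have "order_type R \<beta> = order_type R' \<beta>" if "\<beta> \<in> Dk X k" for \<beta>
  proof -
    have "\<beta> ! i \<in> clopens X" if "i < length \<beta>" for i
      using nth_mem[OF that] \<open>\<beta> \<in> Dk X k\<close> unfolding Dk_iff_clopens by blast
    then show ?thesis unfolding order_type_def using assms by (intro Collect_cong) auto
  qed
  then show ?thesis unfolding pattern_def by (intro restrict_ext) simp
qed

text \<open>Acting on a pattern moves only its order and keeps \<open>\<phi>\<close>; this gives
  both invariance of the set of patterns and equivariance.\<close>

lemma act_Omega_pattern:
  assumes g: "homeomorphic_map X X g"
  shows "act_Omega X k g (pattern X k \<phi> R)
    = pattern X k \<phi> (\<lambda>A B. R (inv_into (topspace X) g ` A) (inv_into (topspace X) g ` B))"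
proof -
  let ?h = "inv_into (topspace X) g"
  have "map (\<lambda>B. ?h ` B) \<beta> \<in> Dk X k" if "\<beta> \<in> Dk X k" for \<beta>
    using homeomorphic_image_Dk[OF homeomorphic_map_inv_into[OF g] that] .
  moreover have "order_type R (map (\<lambda>B. ?h ` B) \<beta>)
      = order_type (\<lambda>A B. R (?h ` A) (?h ` B)) \<beta>" for \<beta>
    by (auto simp: order_type_def)
  ultimately show ?thesis
    unfolding act_Omega_def pattern_def by (intro restrict_ext) simp
qed

lemma chain_order_act_Phi:
  assumes g: "homeomorphic_map X X g" and c: "\<And>F. F \<in> c \<Longrightarrow> F \<subseteq> topspace X"
    and AB: "A \<subseteq> topspace X" "B \<subseteq> topspace X"
  shows "chain_order (act_Phi g c) A B
    \<longleftrightarrow> chain_order c (inv_into (topspace X) g ` A) (inv_into (topspace X) g ` B)"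
proof -
  have inj: "inj_on g (topspace X)" and surj: "g ` topspace X = topspace X"
    using homeomorphic_imp_injective_map[OF g] homeomorphic_imp_surjective_map[OF g] .
  have hit: "g ` F \<inter> D \<noteq> {} \<longleftrightarrow> F \<inter> inv_into (topspace X) g ` D \<noteq> {}"
    if F: "F \<in> c" and D: "D \<subseteq> topspace X" for F D
  proof
    assume "g ` F \<inter> D \<noteq> {}"
    then obtain x where "x \<in> F" "g x \<in> D" by blast
    then have "x \<in> inv_into (topspace X) g ` D"
      using c[OF F] inv_into_f_f[OF inj, of x] by (intro image_eqI[of _ _ "g x"]) auto
    then show "F \<inter> inv_into (topspace X) g ` D \<noteq> {}" using \<open>x \<in> F\<close> by blast
  next
    assume "F \<inter> inv_into (topspace X) g ` D \<noteq> {}"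
    then obtain y where "y \<in> D" "inv_into (topspace X) g y \<in> F" by blast
    moreover from this have "g (inv_into (topspace X) g y) = y"
      using D surj by (intro f_inv_into_f) auto
    ultimately show "g ` F \<inter> D \<noteq> {}" by (metis IntI empty_iff imageI)
  qed
  show ?thesis
    unfolding chain_order_def act_Phi_def ball_simps
    using hit[OF _ AB(1)] hit[OF _ AB(2)] by (intro ball_cong refl) simp
qed

section \<open>Continuity and compactness of patterns\<close>

text \<open>Single comparisons are clopen, and the axioms of \<open>clopen_order\<close> combine
  them by connectives under universal quantifiers; closedness of the set of orders then follows the
  shape of the formula.\<close>

definition clopen_pred :: "'b topology \<Rightarrow> ('b \<Rightarrow> bool) \<Rightarrow> bool" where
  "clopen_pred Y Q \<longleftrightarrow> openin Y {y \<in> topspace Y. Q y} \<and> openin Y {y \<in> topspace Y. \<not> Q y}"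

lemma clopen_pred_not: "clopen_pred Y Q \<Longrightarrow> clopen_pred Y (\<lambda>y. \<not> Q y)"
  by (simp add: clopen_pred_def)

lemma clopen_pred_conj:
  assumes "clopen_pred Y P" "clopen_pred Y Q"
  shows "clopen_pred Y (\<lambda>y. P y \<and> Q y)"
proof -
  have eq: "{y \<in> topspace Y. P y \<and> Q y} = {y \<in> topspace Y. P y} \<inter> {y \<in> topspace Y. Q y}"
    "{y \<in> topspace Y. \<not> (P y \<and> Q y)} = {y \<in> topspace Y. \<not> P y} \<union> {y \<in> topspace Y. \<not> Q y}"
    by auto
  show ?thesis using assms unfolding clopen_pred_def eq by blast
qed

lemma clopen_pred_disj: "clopen_pred Y P \<Longrightarrow> clopen_pred Y Q \<Longrightarrow> clopen_pred Y (\<lambda>y. P y \<or> Q y)"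
  using clopen_pred_not[OF clopen_pred_conj[OF clopen_pred_not clopen_pred_not], of Y P Q] by simp

lemma clopen_pred_imp: "clopen_pred Y P \<Longrightarrow> clopen_pred Y Q \<Longrightarrow> clopen_pred Y (\<lambda>y. P y \<longrightarrow> Q y)"
  using clopen_pred_disj[OF clopen_pred_not, of Y P Q] unfolding imp_conv_disj .

lemma clopen_pred_iff: "clopen_pred Y P \<Longrightarrow> clopen_pred Y Q \<Longrightarrow> clopen_pred Y (\<lambda>y. P y \<longleftrightarrow> Q y)"
  using clopen_pred_conj[OF clopen_pred_imp clopen_pred_imp, of Y P Q Q P] unfolding iff_conv_conj_imp .

lemma clopen_pred_const: "clopen_pred Y (\<lambda>y. b)"
  by (cases b) (simp_all add: clopen_pred_def)

lemma closedin_clopen_pred: "clopen_pred Y Q \<Longrightarrow> closedin Y {y \<in> topspace Y. Q y}"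
proof -
  have "topspace Y - {y \<in> topspace Y. Q y} = {y \<in> topspace Y. \<not> Q y}" by auto
  then show "clopen_pred Y Q \<Longrightarrow> closedin Y {y \<in> topspace Y. Q y}"
    by (auto simp: clopen_pred_def closedin_def)
qed

lemma closedin_Collect_ball:
  assumes "\<And>x. x \<in> I \<Longrightarrow> closedin Y {y \<in> topspace Y. Q x y}"
  shows "closedin Y {y \<in> topspace Y. \<forall>x\<in>I. Q x y}"
proof -
  have eq: "{y \<in> topspace Y. \<forall>x\<in>I. Q x y} = \<Inter>(insert (topspace Y) ((\<lambda>x. {y \<in> topspace Y. Q x y}) ` I))"
    by auto
  show ?thesis unfolding eq by (rule closedin_Inter) (use assms in auto)
qed

lemma closedin_Collect_conj:
  assumes "closedin Y {y \<in> topspace Y. P y}" "closedin Y {y \<in> topspace Y. Q y}"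
  shows "closedin Y {y \<in> topspace Y. P y \<and> Q y}"
proof -
  have eq: "{y \<in> topspace Y. P y \<and> Q y} = {y \<in> topspace Y. P y} \<inter> {y \<in> topspace Y. Q y}" by auto
  show ?thesis unfolding eq using assms by (rule closedin_Int)
qed

text \<open>Each coordinate depends on finitely many comparisons. The parameter space
  \<open>Y\<close> is left open because both the space of chains and the compact space of orders are
  used.\<close>

lemma continuous_map_pattern:
  assumes mem: "\<And>y. y \<in> topspace Y \<Longrightarrow> pattern X k \<phi> (\<rho> y) \<in> topspace (Omega X k)"
    and clo: "\<And>A B. A \<in> clopens X \<Longrightarrow> B \<in> clopens X \<Longrightarrow> clopen_pred Y (\<lambda>y. \<rho> y A B)"
  shows "continuous_map Y (Omega X k) (\<lambda>y. pattern X k \<phi> (\<rho> y))"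
  unfolding Omega_def continuous_map_componentwise
proof (intro conjI ballI)
  show "(\<lambda>y. pattern X k \<phi> (\<rho> y)) ` topspace Y \<subseteq> extensional (Dk X k)"
    by (auto simp: pattern_def)
next
  fix \<beta> assume \<beta>: "\<beta> \<in> Dk X k"
  have val: "pattern X k \<phi> (\<rho> y) \<beta> = \<phi> (order_type (\<rho> y) \<beta>)" for y
    using \<beta> by (simp add: pattern_def)
  let ?I = "{..<k} \<times> {..<k}"
  have sub: "order_type (\<rho> y) \<beta> \<subseteq> ?I" for y
    using \<beta> unfolding order_type_def Dk_def by blast
  have type_iff: "p \<in> order_type (\<rho> y) \<beta> \<longleftrightarrow> \<rho> y (\<beta> ! fst p) (\<beta> ! snd p)" if "p \<in> ?I" for y p
    using \<beta> that by (cases p) (simp add: order_type_def Dk_def)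
  have type_open: "openin Y {y \<in> topspace Y. order_type (\<rho> y) \<beta> = T}" if T: "T \<subseteq> ?I" for T
  proof -
    have "order_type (\<rho> y) \<beta> = T \<longleftrightarrow> (\<forall>p\<in>?I. p \<in> order_type (\<rho> y) \<beta> \<longleftrightarrow> p \<in> T)" for y
      using sub[of y] T by blast
    also have "(\<forall>p\<in>?I. p \<in> order_type (\<rho> y) \<beta> \<longleftrightarrow> p \<in> T)
        \<longleftrightarrow> (\<forall>p\<in>?I. \<rho> y (\<beta> ! fst p) (\<beta> ! snd p) \<longleftrightarrow> p \<in> T)" for y
      using type_iff by (intro ball_cong refl) blast
    finally have "{y \<in> topspace Y. order_type (\<rho> y) \<beta> = T}
        = (\<Inter>p\<in>?I. {y \<in> topspace Y. \<rho> y (\<beta> ! fst p) (\<beta> ! snd p) \<longleftrightarrow> p \<in> T}) \<inter> topspace Y"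
      by blast
    moreover have "openin Y {y \<in> topspace Y. \<rho> y (\<beta> ! fst p) (\<beta> ! snd p) \<longleftrightarrow> p \<in> T}"
      if p: "p \<in> ?I" for p
    proof -
      have mem: "\<beta> ! fst p \<in> clopens X" "\<beta> ! snd p \<in> clopens X"
        using p by (simp_all add: Dk_nth[OF \<beta>] mem_Times_iff)
      show ?thesis
        using clopen_pred_iff[OF clo[OF mem] clopen_pred_const, of "p \<in> T"]
        unfolding clopen_pred_def by simp
    qed
    ultimately show ?thesis by (simp only:) (intro openin_INT, simp_all)
  qed
  show "continuous_map Y (discrete_topology {1, - 1}) (\<lambda>y. pattern X k \<phi> (\<rho> y) \<beta>)"
    unfolding continuous_map_def
  proof (intro conjI allI impI)
    show "(\<lambda>y. pattern X k \<phi> (\<rho> y) \<beta>) \<in> topspace Y \<rightarrow> topspace (discrete_topology {1, - 1})"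
      using mem \<beta> by (auto simp: Omega_def)
  next
    fix U :: "int set"
    have "{y \<in> topspace Y. pattern X k \<phi> (\<rho> y) \<beta> \<in> U}
        = (\<Union>T\<in>{T \<in> Pow ?I. \<phi> T \<in> U}. {y \<in> topspace Y. order_type (\<rho> y) \<beta> = T})"
      unfolding val using sub by blast
    also have "openin Y \<dots>" using type_open by (intro openin_Union) blast
    finally show "openin Y {y \<in> topspace Y. pattern X k \<phi> (\<rho> y) \<beta> \<in> U}" .
  qed
qed

text \<open>Orders form a closed subset of a power of the discrete space \<open>bool\<close>,
  compact by Tychonoff; the patterns are its continuous image in a Hausdorff space.\<close>

lemma closedin_patterns:
  assumes mem: "\<And>R. clopen_order X R \<Longrightarrow> pattern X k \<phi> R \<in> topspace (Omega X k)"
  shows "closedin (Omega X k) {pattern X k \<phi> R | R. clopen_order X R}"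
proof -
  let ?C = "clopens X"
  define Y where "Y = product_topology (\<lambda>_. discrete_topology (UNIV :: bool set)) (?C \<times> ?C)"
  define \<rho> :: "('a set \<times> 'a set \<Rightarrow> bool) \<Rightarrow> 'a set \<Rightarrow> 'a set \<Rightarrow> bool" where "\<rho> r A B = r (A, B)" for r A B
  define L where "L = {r \<in> topspace Y. clopen_order X (\<rho> r)}"
  have lit: "clopen_pred Y (\<lambda>r. \<rho> r A B)" if "A \<in> ?C" "B \<in> ?C" for A B
  proof -
    have "continuous_map Y (discrete_topology UNIV) (\<lambda>r. r (A, B))"
      unfolding Y_def using that by (intro continuous_map_product_projection) simp
    from openin_continuous_map_preimage[OF this, of "{True}"]
      openin_continuous_map_preimage[OF this, of "{False}"]
    show ?thesis by (simp add: clopen_pred_def \<rho>_def)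
  qed
  have closed: "closedin Y L"
    unfolding L_def clopen_order_def
    by (intro closedin_Collect_conj closedin_Collect_ball closedin_clopen_pred clopen_pred_conj
        clopen_pred_disj clopen_pred_imp clopen_pred_iff clopen_pred_not clopen_pred_const lit clopen_Un)
  have "compact_space Y" unfolding Y_def
    by (simp add: compact_space_product_topology compact_space_discrete_topology)
  then have "compactin Y L" using closed by (rule closedin_compact_space)
  then have "compactin (subtopology Y L) L" by (simp add: compactin_subtopology)
  moreover have "continuous_map (subtopology Y L) (Omega X k) (\<lambda>r. pattern X k \<phi> (\<rho> r))"
  proof (rule continuous_map_pattern)
    fix A B assume AB: "A \<in> ?C" "B \<in> ?C"
    have eq: "{r \<in> topspace (subtopology Y L). Q r} = {r \<in> topspace Y. Q r} \<inter> L" for Q by auto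
    show "clopen_pred (subtopology Y L) (\<lambda>r. \<rho> r A B)"
      using lit[OF AB] unfolding clopen_pred_def eq by (blast intro: openin_subtopology_Int)
  qed (use mem in \<open>auto simp: L_def\<close>)
  ultimately have "compactin (Omega X k) ((\<lambda>r. pattern X k \<phi> (\<rho> r)) ` L)"
    by (rule image_compactin)
  moreover have "Hausdorff_space (Omega X k)"
    unfolding Omega_def by (simp add: Hausdorff_space_product_topology)
  ultimately have "closedin (Omega X k) ((\<lambda>r. pattern X k \<phi> (\<rho> r)) ` L)"
    by (simp add: compactin_imp_closedin)
  moreover have "(\<lambda>r. pattern X k \<phi> (\<rho> r)) ` L = {pattern X k \<phi> R | R. clopen_order X R}"
  proof (intro equalityI subsetI)
    fix p assume "p \<in> {pattern X k \<phi> R | R. clopen_order X R}"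
    then obtain R where R: "p = pattern X k \<phi> R" "clopen_order X R" by blast
    \<comment> \<open>Points of the product are extensional, so \<open>R\<close> is restricted to
      pairs of clopen sets, the only pairs a pattern looks at.\<close>
    define r where "r = restrict (\<lambda>(A, B). R A B) (?C \<times> ?C)"
    have eq: "\<rho> r A B = R A B" if "A \<in> ?C" "B \<in> ?C" for A B
      using that by (simp add: \<rho>_def r_def)
    have "r \<in> L"
      using clopen_order_transfer[OF R(2) eq] by (simp add: L_def Y_def) (simp add: r_def)
    moreover have "p = pattern X k \<phi> (\<rho> r)"
      unfolding R(1) using pattern_cong[of X "\<rho> r" R, OF eq] by simp
    ultimately show "p \<in> (\<lambda>r. pattern X k \<phi> (\<rho> r)) ` L" by blast
  qed (auto simp: L_def)
  ultimately show ?thesis by simp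
qed

lemma Dk_UN:
  assumes "\<beta> \<in> Dk X k"
  shows "(\<Union>i<k. \<beta> ! i) = topspace X"
proof -
  have "\<Union>(set \<beta>) = topspace X" "length \<beta> = k" using assms by (simp_all add: Dk_def)
  moreover have "(\<Union>i<length \<beta>. \<beta> ! i) = \<Union>(set \<beta>)" by (auto simp: set_conv_nth)
  ultimately show ?thesis by simp
qed

lemma Dk_disjoint: "\<beta> \<in> Dk X k \<Longrightarrow> i < k \<Longrightarrow> j < k \<Longrightarrow> i \<noteq> j \<Longrightarrow> \<beta> ! i \<inter> \<beta> ! j = {}"
  unfolding Dk_def by blast

section \<open>Refining and moving partitions of an h-homogeneous space\<close>

locale h_homogeneous_compactum = zero_dimensional_compactum +
  assumes infinite: "infinite (topspace X)" and h_homogeneous: "h_homogeneous X"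
begin

text \<open>\<open>C\<close> is homeomorphic to the infinite space \<open>X\<close>, so it has two
  points, and a clopen set separates them.\<close>

lemma split_clopen:
  assumes C: "C \<in> clopens X"
  obtains A B where "A \<in> clopens X" "B \<in> clopens X" "A \<union> B = C" "A \<inter> B = {}"
proof -
  have "subtopology X C homeomorphic_space X"
    using h_homogeneous C by (simp add: h_homogeneous_def clopens_def)
  then obtain f where "homeomorphic_map (subtopology X C) X f"
    unfolding homeomorphic_space by blast
  then have "f ` C = topspace X"
    using homeomorphic_imp_surjective_map[of "subtopology X C" X f] clopen_subset[OF C]
    by (simp add: Int_absorb1)
  then have inf: "infinite C" using infinite by (metis finite_imageI)
  then obtain x where x: "x \<in> C" using infinite_imp_nonempty by blast
  have "C \<noteq> {x}" using inf by auto
  then obtain y where y: "y \<in> C" "y \<noteq> x" using x by blast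
  have "openin X (C - {y})"
    using C y Hausdorff clopen_subset[OF C]
    by (intro openin_diff) (auto simp: clopens_def closedin_Hausdorff_sing_eq)
  then obtain A where A: "A \<in> clopens X" "x \<in> A" "A \<subseteq> C - {y}"
    using clopen_neighbourhood[of "C - {y}" x] x y by blast
  then have "C - A \<noteq> {}" using y by blast
  then have "C - A \<in> clopens X" using clopen_Diff C A(1) by blast
  then show ?thesis using that[of A "C - A"] A by blast
qed

text \<open>Blocks are split one at a time. Adjusts a partition to a prescribed larger size without
  losing what it decides.\<close>

lemma clopen_partition_card:
  assumes "clopen_partition X P" "card P \<le> n"
  shows "\<exists>Q. clopen_partition X Q \<and> card Q = n \<and> (\<forall>D\<in>Q. \<exists>C\<in>P. D \<subseteq> C)"
  using assms(2)
proof (induction n rule: dec_induct)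
  case base
  show ?case using assms(1) by blast
next
  case (step n)
  then obtain Q where Q: "clopen_partition X Q" "card Q = n" "\<And>D. D \<in> Q \<Longrightarrow> \<exists>C\<in>P. D \<subseteq> C"
    by blast
  have fin: "finite Q" and sub: "Q \<subseteq> clopens X" and disj: "pairwise disjnt Q" and un: "\<Union>Q = topspace X"
    using Q(1) by (auto simp: clopen_partition_def)
  obtain C where C: "C \<in> Q" using un nonempty by blast
  obtain A B where AB: "A \<in> clopens X" "B \<in> clopens X" "A \<union> B = C" "A \<inter> B = {}"
    using split_clopen[of C] C sub by blast
  have ne: "A \<noteq> {}" "B \<noteq> {}" using AB by (auto simp: clopens_def)
  have disj_C: "disjnt C D" if "D \<in> Q - {C}" for D
    using disj C that by (auto simp: pairwise_def)
  have A: "A \<notin> Q - {C}" using disj_C[of A] AB(3) ne by (auto simp: disjnt_def)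
  have B: "B \<notin> insert A (Q - {C})" using disj_C[of B] AB(3,4) ne by (auto simp: disjnt_def)
  let ?Q = "insert B (insert A (Q - {C}))"
  have "clopen_partition X ?Q"
    unfolding clopen_partition_def
  proof (intro conjI)
    have "disjnt A D \<and> disjnt D A \<and> disjnt B D \<and> disjnt D B" if "D \<in> Q - {C}" for D
      using disj_C[OF that] AB(3) by (auto simp: disjnt_def)
    moreover have "pairwise disjnt (Q - {C})" using disj by (rule pairwise_subset) blast
    moreover have "disjnt A B \<and> disjnt B A" using AB(4) by (auto simp: disjnt_def)
    ultimately show "pairwise disjnt ?Q"
      unfolding pairwise_insert by (metis insertE)
    have "\<Union>?Q = C \<union> \<Union>(Q - {C})" unfolding AB(3)[symmetric] by (simp add: Un_ac)
    also have "\<dots> = \<Union>(insert C (Q - {C}))" by (rule Union_insert[symmetric])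
    also have "\<dots> = topspace X" unfolding insert_Diff[OF C] by (rule un)
    finally show "\<Union>?Q = topspace X" .
  qed (use fin sub AB in auto)
  moreover have "card ?Q = Suc n"
    using A B fin C Q(2) card_Suc_Diff1[OF fin C] by simp
  moreover have "\<exists>C\<in>P. D \<subseteq> C" if "D \<in> ?Q" for D
  proof -
    have "D \<in> Q \<or> D \<subseteq> C" using that unfolding AB(3)[symmetric] by auto
    then show ?thesis using Q(3)[of D] Q(3)[OF C] by (meson order_trans)
  qed
  ultimately show ?case by (intro exI[of _ ?Q]) simp
qed

lemma clopen_partition_deciding:
  assumes "finite \<A>" "\<A> \<subseteq> clopens X"
  shows "\<exists>P. clopen_partition X P \<and> (\<forall>C\<in>P. \<forall>A\<in>\<A>. C \<subseteq> A \<or> C \<inter> A = {})"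
  using assms
proof (induction rule: finite_induct)
  case empty
  have "clopen_partition X {topspace X}"
    using nonempty by (simp add: clopen_partition_def clopens_def)
  then show ?case by blast
next
  case (insert A \<A>)
  then obtain P where P: "clopen_partition X P" "\<And>C A. C \<in> P \<Longrightarrow> A \<in> \<A> \<Longrightarrow> C \<subseteq> A \<or> C \<inter> A = {}"
    by auto
  have fin: "finite P" and sub: "P \<subseteq> clopens X" and disj: "pairwise disjnt P" and un: "\<Union>P = topspace X"
    using P(1) by (auto simp: clopen_partition_def)
  have A: "openin X A" "closedin X A" using insert.prems by (auto simp: clopens_def)
  let ?Q = "((\<lambda>C. C \<inter> A) ` P \<union> (\<lambda>C. C - A) ` P) - {{}}"
  have origin: "\<exists>C\<in>P. D = C \<inter> A \<or> D = C - A" if "D \<in> ?Q" for D using that by blast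
  have "clopen_partition X ?Q"
    unfolding clopen_partition_def
  proof (intro conjI)
    show "?Q \<subseteq> clopens X"
    proof
      fix D assume D: "D \<in> ?Q"
      then obtain C where C: "C \<in> P" "D = C \<inter> A \<or> D = C - A" using origin by blast
      then have "openin X C" "closedin X C" using sub by (auto simp: clopens_def)
      then have "openin X D" "closedin X D"
        using C(2) A by (auto intro: openin_diff closedin_diff)
      then show "D \<in> clopens X" using D by (simp add: clopens_def)
    qed
    show "pairwise disjnt ?Q"
    proof (rule pairwiseI)
      fix D E assume "D \<in> ?Q" "E \<in> ?Q" "D \<noteq> E"
      then obtain C C' where C: "C \<in> P" "D = C \<inter> A \<or> D = C - A" "C' \<in> P" "E = C' \<inter> A \<or> E = C' - A"
        using origin by meson
      show "disjnt D E"
      proof (cases "C = C'")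
        case True
        then show ?thesis using C \<open>D \<noteq> E\<close> by (auto simp: disjnt_def)
      next
        case False
        then have "disjnt C C'" using disj C by (auto simp: pairwise_def)
        then show ?thesis using C by (auto simp: disjnt_def)
      qed
    qed
    show "\<Union>?Q = topspace X"
    proof (intro equalityI subsetI)
      fix x assume "x \<in> \<Union>?Q"
      then obtain D where "D \<in> ?Q" "x \<in> D" by blast
      then obtain C where "C \<in> P" "x \<in> C" using origin by blast
      then show "x \<in> topspace X" using un by blast
    next
      fix x assume "x \<in> topspace X"
      then obtain C where C: "C \<in> P" "x \<in> C" using un by blast
      show "x \<in> \<Union>?Q"
      proof (cases "x \<in> A")
        case True
        then have "x \<in> C \<inter> A" "C \<inter> A \<in> ?Q" using C by auto
        then show ?thesis by (rule UnionI[rotated])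
      next
        case False
        then have "x \<in> C - A" "C - A \<in> ?Q" using C by auto
        then show ?thesis by (rule UnionI[rotated])
      qed
    qed
  qed (use fin in simp)
  moreover have "D \<subseteq> B \<or> D \<inter> B = {}" if D: "D \<in> ?Q" "B \<in> insert A \<A>" for D B
  proof -
    obtain C where C: "C \<in> P" "D = C \<inter> A \<or> D = C - A" using origin[OF D(1)] by blast
    show ?thesis
    proof (cases "B = A")
      case False
      then have "C \<subseteq> B \<or> C \<inter> B = {}" using P(2) C(1) D(2) by blast
      then show ?thesis using C(2) by blast
    qed (use C(2) in blast)
  qed
  ultimately show ?case by blast
qed

text \<open>Corresponding pieces are homeomorphic, both being copies of \<open>X\<close>; the glued
  map is a continuous bijection of a compact Hausdorff space.\<close>

lemma homeo_between_partitions: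
  assumes \<gamma>: "\<gamma> \<in> Dk X n" and \<gamma>': "\<gamma>' \<in> Dk X n"
  obtains g where "g \<in> homeo X" "\<And>i. i < n \<Longrightarrow> g ` (\<gamma> ! i) = \<gamma>' ! i"
proof -
  have hom: "subtopology X C homeomorphic_space X" if "C \<in> clopens X" for C
    using h_homogeneous that by (simp add: h_homogeneous_def clopens_def)
  have "\<exists>h. homeomorphic_map (subtopology X (\<gamma> ! i)) (subtopology X (\<gamma>' ! i)) h" if "i < n" for i
  proof -
    have "subtopology X (\<gamma> ! i) homeomorphic_space subtopology X (\<gamma>' ! i)"
      using hom[OF Dk_nth[OF \<gamma> that]] hom[OF Dk_nth[OF \<gamma>' that], unfolded homeomorphic_space_sym[of _ X]]
      by (rule homeomorphic_space_trans)
    then show ?thesis unfolding homeomorphic_space .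
  qed
  then obtain h where h: "\<And>i. i < n \<Longrightarrow>
      homeomorphic_map (subtopology X (\<gamma> ! i)) (subtopology X (\<gamma>' ! i)) (h i)"
    by metis
  have sub: "\<gamma> ! i \<subseteq> topspace X" "\<gamma>' ! i \<subseteq> topspace X" if "i < n" for i
    using clopen_subset[OF Dk_nth[OF \<gamma> that]] clopen_subset[OF Dk_nth[OF \<gamma>' that]] .
  have un: "topspace X = (\<Union>i<n. \<gamma> ! i)" "topspace X = (\<Union>i<n. \<gamma>' ! i)"
    using Dk_UN[OF \<gamma>] Dk_UN[OF \<gamma>'] by simp_all
  have disj: "\<gamma> ! i \<inter> \<gamma> ! j = {}" "\<gamma>' ! i \<inter> \<gamma>' ! j = {}" if "i < n" "j < n" "i \<noteq> j" for i j
    using Dk_disjoint[OF \<gamma> that] Dk_disjoint[OF \<gamma>' that] .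
  obtain g where g: "continuous_map X X g"
    "\<And>x i. \<lbrakk>i \<in> {..<n}; x \<in> topspace X \<inter> \<gamma> ! i\<rbrakk> \<Longrightarrow> g x = h i x"
  proof (rule pasting_lemma_exists[where X=X and I="{..<n}" and T="\<lambda>i. \<gamma> ! i" and Y=X and f=h])
    show "topspace X \<subseteq> (\<Union>i\<in>{..<n}. \<gamma> ! i)" using Dk_UN[OF \<gamma>] by simp
    show "openin X (\<gamma> ! i)" if "i \<in> {..<n}" for i
      using Dk_nth[OF \<gamma>, of i] that by (simp add: clopens_def)
    show "continuous_map (subtopology X (\<gamma> ! i)) X (h i)" if "i \<in> {..<n}" for i
      using homeomorphic_imp_continuous_map[OF h[of i]] that
      by (rule_tac continuous_map_into_fulltopology) simp
    show "h i x = h j x" if "i \<in> {..<n}" "j \<in> {..<n}" "x \<in> topspace X \<inter> \<gamma> ! i \<inter> \<gamma> ! j" for i j x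
    proof -
      have "i = j" using disj(1)[of i j] that by blast
      then show ?thesis by simp
    qed
    fix g' assume "continuous_map X X g'"
      "\<And>x i. \<lbrakk>i \<in> {..<n}; x \<in> topspace X \<inter> \<gamma> ! i\<rbrakk> \<Longrightarrow> g' x = h i x"
    then show thesis by (rule that)
  qed
  have gh: "g x = h i x" if "i < n" "x \<in> \<gamma> ! i" for i x
    using g(2)[of i x] subsetD[OF sub(1)[OF that(1)] that(2)] that by simp
  have img: "g ` (\<gamma> ! i) = \<gamma>' ! i" if i: "i < n" for i
  proof -
    have "g ` (\<gamma> ! i) = h i ` (\<gamma> ! i)" using gh[OF i] by (rule image_cong[OF refl])
    also have "\<dots> = \<gamma>' ! i"
      using homeomorphic_imp_surjective_map[OF h[OF i]] sub[OF i] by (simp add: Int_absorb1)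
    finally show ?thesis .
  qed
  have "g ` topspace X = topspace X"
  proof -
    have "g ` topspace X = (\<Union>i<n. g ` (\<gamma> ! i))" unfolding un(1) by (rule image_UN)
    also have "\<dots> = topspace X" unfolding un(2) using img by simp
    finally show ?thesis .
  qed
  moreover have "inj_on g (topspace X)"
  proof (rule inj_onI)
    fix x y assume xy: "x \<in> topspace X" "y \<in> topspace X" "g x = g y"
    obtain i j where ij: "i < n" "x \<in> \<gamma> ! i" "j < n" "y \<in> \<gamma> ! j"
      using xy(1,2) unfolding un(1) by blast
    have "g x \<in> \<gamma>' ! i" "g x \<in> \<gamma>' ! j"
      using imageI[OF ij(2), of g] imageI[OF ij(4), of g] img[OF ij(1)] img[OF ij(3)] xy(3) by simp_all
    then have "i = j" using disj(2)[OF ij(1,3)] by blast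
    moreover have "inj_on (h i) (\<gamma> ! i)"
      using homeomorphic_imp_injective_map[OF h[OF ij(1)]] sub[OF ij(1)]
      by (simp add: Int_absorb1)
    ultimately show "x = y"
      using gh[OF ij(1,2)] gh[OF ij(3,4)] xy(3) ij(2,4) by (simp add: inj_on_def)
  qed
  ultimately have "homeomorphic_map X X g"
    using continuous_imp_homeomorphic_map[OF g(1) compact Hausdorff] by blast
  then show ?thesis using that[of g] img by (simp add: homeo_def)
qed

end

section \<open>Minimal subsystems consist of patterns\<close>

context h_homogeneous_compactum
begin

text \<open>A surjective labelling \<open>s\<close> is a rigid word followed by the renumbering
  \<open>\<pi> T\<close>, where \<open>T\<close> is its order of first positions. Colouring rigid
  words by the values of \<open>\<omega>\<close> under all renumberings yields one value for each
  \<open>T\<close>.\<close>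

lemma monochromatic_partition:
  assumes C: "finite C" "\<And>\<beta>. \<omega> \<beta> \<in> C" and m: "m \<ge> 1"
  shows "\<exists>\<phi>\<in>Pow ({..<k} \<times> {..<k}) \<rightarrow>\<^sub>E C. \<exists>\<gamma>\<in>Dk X m. \<forall>s. length s = m \<and> set s = {..<k}
    \<longrightarrow> \<omega> (coarsen s \<gamma> k) = \<phi> (first_pos_order k s)"
proof -
  let ?T = "Pow ({..<k} \<times> {..<k})"
  define \<pi> where "\<pi> T = inv_into {..<k} (rank T)" for T
  obtain n where n: "ramsey k 0 m (card C ^ card ?T) n" using graham_rothschild by blast
  have topspace_partition: "clopen_partition X {topspace X}"
    using nonempty by (simp add: clopen_partition_def clopens_def)
  \<comment> \<open>The one-block partition will be refined to \<open>n\<close> blocks, so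
    \<open>n\<close> must be positive.\<close>
  have "n \<ge> 1"
  proof -
    obtain w where w: "length w = n" "rigid 0 (0 + m) w"
    proof (rule ramseyD[OF n, of "\<lambda>_. 0"])
      show "0 < card C ^ card ?T" using C by (metis card_gt_0_iff empty_iff zero_less_power)
    qed
    then have "w \<noteq> []" using m by auto
    then show ?thesis using w(1) by (cases w) auto
  qed
  then obtain Q where Q: "clopen_partition X Q" "card Q = n"
    using clopen_partition_card[OF topspace_partition, of n] by auto
  obtain E where "set E = Q" "distinct E"
    using finite_distinct_list[of Q] Q(1) by (auto simp: clopen_partition_def)
  then have E: "E \<in> Dk X n"
    using distinct_enumeration_in_Dk[of E X] Q distinct_card[of E] by simp
  then have E_len: "length E = n" by (simp add: Dk_def)
  obtain e :: "nat list \<Rightarrow> nat" where e: "\<And>u. e u < card C ^ card ?T"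
    "\<And>u v T. \<lbrakk>e u = e v; T \<in> ?T\<rbrakk> \<Longrightarrow>
      \<omega> (coarsen (map (\<pi> T) u) E k) = \<omega> (coarsen (map (\<pi> T) v) E k)"
  proof (rule encode_vectors[of ?T C "\<lambda>u T. \<omega> (coarsen (map (\<pi> T) u) E k)"])
    fix e :: "nat list \<Rightarrow> nat"
    assume "\<And>u. e u < card C ^ card ?T"
      "\<And>u v T. \<lbrakk>e u = e v; T \<in> ?T\<rbrakk> \<Longrightarrow>
        \<omega> (coarsen (map (\<pi> T) u) E k) = \<omega> (coarsen (map (\<pi> T) v) E k)"
    then show thesis by (rule that)
  qed (use C in auto)
  obtain w col where w: "length w = n" "rigid 0 (0 + m) w"
    "\<And>u. \<lbrakk>length u = m; rigid 0 (0 + k) u\<rbrakk> \<Longrightarrow> e (subst 0 u w) = col"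
    using ramseyD[OF n, of e] e(1) by blast
  have w_set: "set w = {..<m}"
    using rigid_set[OF w(2)] rigid_surj[OF w(2)] by auto
  define \<gamma> where "\<gamma> = coarsen w E m"
  have \<gamma>: "\<gamma> \<in> Dk X m" unfolding \<gamma>_def using coarsen_in_Dk[OF E w(1) w_set] .
  \<comment> \<open>Any list of colour \<open>col\<close> carries the common vector of values, from
    which \<open>\<phi>\<close> is read off.\<close>
  define v where "v = (SOME v. e v = col)"
  define \<phi> where "\<phi> = restrict (\<lambda>T. \<omega> (coarsen (map (\<pi> T) v) E k)) ?T"
  have "\<omega> (coarsen s \<gamma> k) = \<phi> (first_pos_order k s)" if s: "length s = m" "set s = {..<k}" for s
  proof -
    define T where "T = first_pos_order k s"
    have T: "T \<in> ?T" by (auto simp: T_def first_pos_order_def)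
    define u where "u = map (rank T) s"
    have u: "rigid 0 k u" "map (\<pi> T) u = s"
      using rigid_rank[OF s(2)] by (simp_all add: u_def \<pi>_def T_def)
    have u_len: "length u = m" using s(1) by (simp add: u_def)
    have letter: "letter 0 u c = u ! c" for c by (simp add: letter_def)
    have "e (subst 0 u w) = col" using w(3) u(1) u_len by simp
    then have col: "e (subst 0 u w) = e v"
      unfolding v_def using someI[of "\<lambda>v. e v = col"] by metis
    have "map (\<lambda>c. s ! c) w = map (\<pi> T) (subst 0 u w)"
    proof (rule nth_equalityI)
      fix l assume "l < length (map (\<lambda>c. s ! c) w)"
      then have l: "l < length w" by simp
      then have "w ! l < m" using w_set nth_mem by blast
      then have "\<pi> T (u ! (w ! l)) = s ! (w ! l)" using u(2) u_len by (metis nth_map)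
      then show "map (\<lambda>c. s ! c) w ! l = map (\<pi> T) (subst 0 u w) ! l" using l letter by simp
    qed simp
    moreover have "coarsen s \<gamma> k = coarsen (map (\<lambda>c. s ! c) w) E k"
      unfolding \<gamma>_def using coarsen_coarsen[of w E m s k] w(1) E_len w_set by simp
    ultimately have "\<omega> (coarsen s \<gamma> k) = \<omega> (coarsen (map (\<pi> T) (subst 0 u w)) E k)" by (simp only:)
    also have "\<dots> = \<omega> (coarsen (map (\<pi> T) v) E k)" by (rule e(2)[OF col T])
    also have "\<dots> = \<phi> (first_pos_order k s)" using T unfolding \<phi>_def T_def[symmetric] by simp
    finally show ?thesis .
  qed
  moreover have "\<phi> \<in> ?T \<rightarrow>\<^sub>E C" unfolding \<phi>_def using C(2) by (simp add: restrict_PiE_iff)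
  ultimately show ?thesis using \<gamma> by blast
qed

text \<open>No piece is cut by \<open>\<beta>\<close>, so each lies in one block, and the index of
  that block is its label.\<close>

lemma coarsening_of_deciding_partition:
  assumes \<gamma>: "\<gamma> \<in> Dk X m" and \<beta>: "\<beta> \<in> Dk X k"
    and dec: "\<And>l A. l < m \<Longrightarrow> A \<in> set \<beta> \<Longrightarrow> \<gamma> ! l \<subseteq> A \<or> \<gamma> ! l \<inter> A = {}"
  obtains s where "length s = m" "set s = {..<k}" "coarsen s \<gamma> k = \<beta>"
proof -
  have len: "length \<beta> = k" "length \<gamma> = m" using \<beta> \<gamma> by (simp_all add: Dk_def)
  have ne: "\<gamma> ! l \<noteq> {}" if "l < m" for l using Dk_nth[OF \<gamma> that] by (simp add: clopens_def)
  have "\<exists>i<k. \<gamma> ! l \<subseteq> \<beta> ! i" if l: "l < m" for l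
  proof -
    obtain x where x: "x \<in> \<gamma> ! l" using ne[OF l] by blast
    then have "x \<in> (\<Union>i<k. \<beta> ! i)"
      using clopen_subset[OF Dk_nth[OF \<gamma> l]] unfolding Dk_UN[OF \<beta>] by blast
    then obtain i where i: "i < k" "x \<in> \<beta> ! i" by blast
    then have "\<beta> ! i \<in> set \<beta>" using len by simp
    then show ?thesis using dec[OF l] i x by blast
  qed
  then obtain t where t: "\<And>l. l < m \<Longrightarrow> t l < k \<and> \<gamma> ! l \<subseteq> \<beta> ! t l" by metis
  define s where "s = map t [0..<m]"
  have s: "length s = m" "\<And>l. l < m \<Longrightarrow> s ! l = t l" by (simp_all add: s_def)
  have nth: "\<beta> ! i = (\<Union>l\<in>{l. l < m \<and> t l = i}. \<gamma> ! l)" if i: "i < k" for i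
  proof (intro equalityI subsetI)
    fix x assume x: "x \<in> \<beta> ! i"
    then have "x \<in> (\<Union>l<m. \<gamma> ! l)"
      using clopen_subset[OF Dk_nth[OF \<beta> i]] unfolding Dk_UN[OF \<gamma>] by blast
    then obtain l where l: "l < m" "x \<in> \<gamma> ! l" by blast
    then have "x \<in> \<beta> ! t l" "t l < k" using t by blast+
    then have "t l = i" using Dk_disjoint[OF \<beta>, of "t l" i] i x by blast
    then show "x \<in> (\<Union>l\<in>{l. l < m \<and> t l = i}. \<gamma> ! l)" using l by blast
  next
    fix x assume "x \<in> (\<Union>l\<in>{l. l < m \<and> t l = i}. \<gamma> ! l)"
    then show "x \<in> \<beta> ! i" using t by blast
  qed
  have "coarsen s \<gamma> k = \<beta>"
  proof (rule nth_equalityI)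
    fix i assume "i < length (coarsen s \<gamma> k)"
    then have i: "i < k" by simp
    have "{l. l < length \<gamma> \<and> s ! l = i} = {l. l < m \<and> t l = i}" using s len by auto
    then show "coarsen s \<gamma> k ! i = \<beta> ! i" unfolding nth_coarsen[OF i] nth[OF i] by simp
  qed (simp add: len)
  moreover have "set s = {..<k}"
  proof (intro equalityI subsetI)
    fix i assume "i \<in> {..<k}"
    then have i: "i < k" by simp
    have "\<beta> ! i \<noteq> {}" using Dk_nth[OF \<beta> i] by (simp add: clopens_def)
    then obtain l where "l < m" "t l = i" unfolding nth[OF i] by blast
    then show "i \<in> set s" unfolding s_def by auto
  qed (use t in \<open>auto simp: s_def\<close>)
  ultimately show ?thesis using that s(1) by blast
qed

text \<open>The pigeonhole principle yields a \<open>\<phi>\<close> that is good for infinitely many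
  \<open>m\<close>, hence for some \<open>m\<close> at least the size of any partition deciding the
  blocks of all members of \<open>J\<close>.\<close>

lemma orbit_approximates_patterns:
  assumes \<omega>: "\<omega> \<in> topspace (Omega X k)"
  obtains \<phi> where "\<And>R J. \<lbrakk>clopen_order X R; finite J; J \<subseteq> Dk X k\<rbrakk> \<Longrightarrow>
    \<exists>g\<in>homeo X. \<forall>\<beta>\<in>J. act_Omega X k g \<omega> \<beta> = \<phi> (order_type R \<beta>)"
proof -
  \<comment> \<open>\<open>undefined\<close> is the value of \<open>\<omega>\<close> outside
    \<open>Dk X k\<close>; including it bounds \<open>\<omega>\<close> on all lists.\<close>
  let ?C = "{1, -1, undefined :: int}"
  let ?\<Phi> = "Pow ({..<k} \<times> {..<k}) \<rightarrow>\<^sub>E ?C"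
  define good where "good m \<phi> \<longleftrightarrow> (\<exists>\<gamma>\<in>Dk X m. \<forall>s. length s = m \<and> set s = {..<k}
    \<longrightarrow> \<omega> (coarsen s \<gamma> k) = \<phi> (first_pos_order k s))" for m \<phi>
  have val: "\<omega> \<beta> \<in> ?C" for \<beta>
  proof (cases "\<beta> \<in> Dk X k")
    case True
    then have "\<omega> \<beta> \<in> {1, -1}" using \<omega> by (simp add: Omega_def PiE_iff)
    then show ?thesis by blast
  next
    case False
    then have "\<omega> \<beta> = undefined" using \<omega> by (simp add: Omega_def PiE_iff extensional_def)
    then show ?thesis by simp
  qed
  have "\<exists>\<phi>\<in>?\<Phi>. good m \<phi>" if "m \<in> {1..}" for m
    unfolding good_def by (rule monochromatic_partition) (use val that in auto)
  moreover have "finite ?\<Phi>" by (intro finite_PiE) simp_all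
  moreover have "infinite {1::nat..}" by (rule infinite_Ici)
  ultimately obtain \<phi> where \<phi>: "infinite {m \<in> {1..}. good m \<phi>}"
    using pigeonhole_infinite_rel[of "{1..}" ?\<Phi> good] by blast
  show ?thesis
  proof (rule that[of \<phi>])
    fix R :: "'a set \<Rightarrow> 'a set \<Rightarrow> bool" and J
    assume R: "clopen_order X R" and J: "finite J" "J \<subseteq> Dk X k"
    have pieces: "finite (\<Union>\<beta>\<in>J. set \<beta>)" using J(1) by simp
    have pieces': "(\<Union>\<beta>\<in>J. set \<beta>) \<subseteq> clopens X"
    proof (rule UN_least)
      fix \<beta> assume "\<beta> \<in> J"
      then have "\<beta> \<in> Dk X k" using J(2) by blast
      then show "set \<beta> \<subseteq> clopens X" by (simp add: Dk_iff_clopens)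
    qed
    obtain P where P: "clopen_partition X P"
      "\<And>C A. C \<in> P \<Longrightarrow> A \<in> (\<Union>\<beta>\<in>J. set \<beta>) \<Longrightarrow> C \<subseteq> A \<or> C \<inter> A = {}"
      using clopen_partition_deciding[OF pieces pieces'] by (elim exE conjE) (rule that, assumption, blast)
    obtain m where m: "card P \<le> m" "good m \<phi>"
      using \<phi> unfolding infinite_nat_iff_unbounded_le by blast
    obtain Q where Q: "clopen_partition X Q" "card Q = m" "\<And>D. D \<in> Q \<Longrightarrow> \<exists>C\<in>P. D \<subseteq> C"
      using clopen_partition_card[OF P(1) m(1)] by blast
    obtain \<gamma> where \<gamma>: "\<gamma> \<in> Dk X m" "set \<gamma> = Q"
      "\<And>l l'. l < length \<gamma> \<Longrightarrow> l' < length \<gamma> \<Longrightarrow> R (\<gamma> ! l) (\<gamma> ! l') \<longleftrightarrow> l \<le> l'"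
      using clopen_partition_enumeration[OF R Q(1)] Q(2) by metis
    have \<gamma>_len: "length \<gamma> = m" using \<gamma>(1) by (simp add: Dk_def)
    obtain \<gamma>' where \<gamma>': "\<gamma>' \<in> Dk X m"
      "\<And>s. \<lbrakk>length s = m; set s = {..<k}\<rbrakk> \<Longrightarrow> \<omega> (coarsen s \<gamma>' k) = \<phi> (first_pos_order k s)"
      using m(2) unfolding good_def by blast
    \<comment> \<open>\<open>g\<close> carries the homogeneous partition \<open>\<gamma>'\<close> to
      the \<open>R\<close>-sorted \<open>\<gamma>\<close>, so the moved point reads at a coarsening
      of \<open>\<gamma>\<close> what \<open>\<omega>\<close> reads at the same coarsening of
      \<open>\<gamma>'\<close>.\<close>
    obtain g where g: "g \<in> homeo X" "\<And>i. i < m \<Longrightarrow> g ` (\<gamma>' ! i) = \<gamma> ! i"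
      using homeo_between_partitions[OF \<gamma>'(1) \<gamma>(1)] by blast
    have inj: "inj_on g (topspace X)"
      using g(1) homeomorphic_imp_injective_map unfolding homeo_def by blast
    have pull_back: "map (\<lambda>B. inv_into (topspace X) g ` B) \<gamma> = \<gamma>'"
    proof (rule nth_equalityI)
      show "length (map (\<lambda>B. inv_into (topspace X) g ` B) \<gamma>) = length \<gamma>'"
        using \<gamma>'(1) \<gamma>_len by (simp add: Dk_def)
      fix i assume "i < length (map (\<lambda>B. inv_into (topspace X) g ` B) \<gamma>)"
      then have i: "i < m" using \<gamma>_len by simp
      have "inv_into (topspace X) g ` (g ` (\<gamma>' ! i)) = \<gamma>' ! i"
        by (rule inv_into_image_cancel[OF inj clopen_subset[OF Dk_nth[OF \<gamma>'(1) i]]])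
      then show "map (\<lambda>B. inv_into (topspace X) g ` B) \<gamma> ! i = \<gamma>' ! i"
        using g(2)[OF i] i \<gamma>_len by simp
    qed
    have "act_Omega X k g \<omega> \<beta> = \<phi> (order_type R \<beta>)" if \<beta>: "\<beta> \<in> J" for \<beta>
    proof -
      have \<beta>_Dk: "\<beta> \<in> Dk X k" using \<beta> J(2) by blast
      have "\<gamma> ! l \<subseteq> A \<or> \<gamma> ! l \<inter> A = {}" if "l < m" "A \<in> set \<beta>" for l A
      proof -
        have "\<gamma> ! l \<in> Q" using that(1) \<gamma>_len nth_mem[of l \<gamma>] \<gamma>(2) by simp
        then obtain C where "C \<in> P" "\<gamma> ! l \<subseteq> C" using Q(3) by blast
        then show ?thesis using P(2)[of C A] that(2) \<beta> by blast
      qed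
      then obtain s where s: "length s = m" "set s = {..<k}" "coarsen s \<gamma> k = \<beta>"
        using coarsening_of_deciding_partition[OF \<gamma>(1) \<beta>_Dk] by blast
      have "map (\<lambda>B. inv_into (topspace X) g ` B) \<beta> = coarsen s \<gamma>' k"
        unfolding s(3)[symmetric] map_image_coarsen pull_back ..
      then have "act_Omega X k g \<omega> \<beta> = \<omega> (coarsen s \<gamma>' k)"
        unfolding act_Omega_def restrict_apply'[OF \<beta>_Dk] by (rule arg_cong)
      also have "\<dots> = \<phi> (first_pos_order k s)" by (rule \<gamma>'(2)[OF s(1,2)])
      also have "first_pos_order k s = order_type R (coarsen s \<gamma> k)"
      proof (rule order_type_coarsen[OF R _ _ s(2), symmetric])
        show "set \<gamma> \<subseteq> clopens X" using \<gamma>(1) by (simp add: Dk_iff_clopens)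
        show "length s = length \<gamma>" using s(1) \<gamma>_len by simp
        show "R (\<gamma> ! l) (\<gamma> ! l') \<longleftrightarrow> l \<le> l'" if "l < length \<gamma>" "l' < length \<gamma>" for l l'
          by (rule \<gamma>(3)[OF that])
      qed
      finally show ?thesis unfolding s(3) .
    qed
    then show "\<exists>g\<in>homeo X. \<forall>\<beta>\<in>J. act_Omega X k g \<omega> \<beta> = \<phi> (order_type R \<beta>)"
      using g(1) by blast
  qed
qed

text \<open>A basic neighbourhood restricts finitely many coordinates, so matching the pattern on
  every finite \<open>J\<close> puts it into the closure of the orbit.\<close>

lemma patterns_in_invariant_set:
  assumes closed: "closedin (Omega X k) \<Sigma>" and inv: "invariant_set (act_Omega X k) (homeo X) \<Sigma>"
    and ne: "\<Sigma> \<noteq> {}"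
  obtains \<phi> where "\<And>R. clopen_order X R \<Longrightarrow> pattern X k \<phi> R \<in> \<Sigma>"
proof -
  have sub: "\<Sigma> \<subseteq> topspace (Omega X k)" using closed by (rule closedin_subset)
  obtain \<omega> where \<omega>: "\<omega> \<in> \<Sigma>" using ne by blast
  then have \<omega>_top: "\<omega> \<in> topspace (Omega X k)" using sub by blast
  obtain \<phi> where \<phi>: "\<And>R J. \<lbrakk>clopen_order X R; finite J; J \<subseteq> Dk X k\<rbrakk> \<Longrightarrow>
    \<exists>g\<in>homeo X. \<forall>\<beta>\<in>J. act_Omega X k g \<omega> \<beta> = \<phi> (order_type R \<beta>)"
    using orbit_approximates_patterns[OF \<omega>_top] by blast
  have orbit: "act_Omega X k g \<omega> \<in> \<Sigma>" if "g \<in> homeo X" for g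
    using inv \<omega> that by (simp add: invariant_set_def)
  have topspace_Omega: "topspace (Omega X k) = (\<Pi>\<^sub>E \<beta>\<in>Dk X k. {1, -1})" by (simp add: Omega_def)
  show ?thesis
  proof (rule that[of \<phi>])
    fix R assume R: "clopen_order X R"
    let ?p = "pattern X k \<phi> R"
    have val: "?p \<beta> = \<phi> (order_type R \<beta>)" if "\<beta> \<in> Dk X k" for \<beta>
      using that by (simp add: pattern_def)
    \<comment> \<open>The function \<open>\<phi>\<close> is not known to have values 1 and -1; at an
      order type that occurs, its value is a coordinate of an orbit point.\<close>
    have "?p \<in> (\<Pi>\<^sub>E \<beta>\<in>Dk X k. {1, -1})"
    proof (rule PiE_I)
      fix \<beta> assume \<beta>: "\<beta> \<in> Dk X k"
      then obtain g where g: "g \<in> homeo X" "act_Omega X k g \<omega> \<beta> = \<phi> (order_type R \<beta>)"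
        using \<phi>[OF R, of "{\<beta>}"] by auto
      have "act_Omega X k g \<omega> \<in> (\<Pi>\<^sub>E \<beta>\<in>Dk X k. {1, -1})"
        using orbit[OF g(1)] sub unfolding topspace_Omega by blast
      then have "act_Omega X k g \<omega> \<beta> \<in> {1, -1}" using \<beta> by (rule PiE_mem)
      then show "?p \<beta> \<in> {1, -1}" using val[OF \<beta>] g(2) by simp
    qed (simp add: pattern_def)
    then have p_top: "?p \<in> topspace (Omega X k)" unfolding topspace_Omega .
    show "?p \<in> \<Sigma>"
    proof (rule ccontr)
      assume "?p \<notin> \<Sigma>"
      then have "?p \<in> topspace (Omega X k) - \<Sigma>" using p_top by blast
      moreover have "openin (Omega X k) (topspace (Omega X k) - \<Sigma>)" using closed by blast
      ultimately obtain U where U: "finite {\<beta> \<in> Dk X k. U \<beta> \<noteq> {1, -1}}"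
        "?p \<in> Pi\<^sub>E (Dk X k) U" "Pi\<^sub>E (Dk X k) U \<subseteq> topspace (Omega X k) - \<Sigma>"
        unfolding Omega_def openin_product_topology_alt topspace_discrete_topology by meson
      let ?J = "{\<beta> \<in> Dk X k. U \<beta> \<noteq> {1, -1}}"
      obtain g where g: "g \<in> homeo X"
        "\<And>\<beta>. \<beta> \<in> ?J \<Longrightarrow> act_Omega X k g \<omega> \<beta> = \<phi> (order_type R \<beta>)"
        using \<phi>[OF R U(1)] by blast
      have g_top: "act_Omega X k g \<omega> \<in> (\<Pi>\<^sub>E \<beta>\<in>Dk X k. {1, -1})"
        using orbit[OF g(1)] sub unfolding topspace_Omega by blast
      have "act_Omega X k g \<omega> \<in> Pi\<^sub>E (Dk X k) U"
      proof (rule PiE_I)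
        fix \<beta> assume \<beta>: "\<beta> \<in> Dk X k"
        show "act_Omega X k g \<omega> \<beta> \<in> U \<beta>"
        proof (cases "U \<beta> = {1, -1}")
          case True
          then show ?thesis using PiE_mem[OF g_top \<beta>] by simp
        next
          case False
          then have "act_Omega X k g \<omega> \<beta> = ?p \<beta>" using g(2)[of \<beta>] val \<beta> by simp
          then show ?thesis using PiE_mem[OF U(2) \<beta>] by simp
        qed
      qed (simp add: act_Omega_def)
      then show False using U(3) orbit[OF g(1)] by blast
    qed
  qed
qed

theorem minimal_subsystem_factor:
  assumes min: "minimal_subsystem (Omega X k) (act_Omega X k) (homeo X) \<Sigma>"
  shows "\<exists>f. continuous_map (Phi_space X) (subtopology (Omega X k) \<Sigma>) f \<and>
             f ` topspace (Phi_space X) = \<Sigma> \<and>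
             (\<forall>g\<in>homeo X. \<forall>c\<in>topspace (Phi_space X). f (act_Phi g c) = act_Omega X k g (f c))"
proof -
  have \<Sigma>: "\<Sigma> \<noteq> {}" "closedin (Omega X k) \<Sigma>" "invariant_set (act_Omega X k) (homeo X) \<Sigma>"
    using min unfolding minimal_subsystem_def by simp_all
  have minimal: "S = \<Sigma>" if "S \<noteq> {}" "closedin (Omega X k) S"
    "invariant_set (act_Omega X k) (homeo X) S" "S \<subseteq> \<Sigma>" for S
    using min that unfolding minimal_subsystem_def by simp
  obtain \<phi> where \<phi>: "\<And>R. clopen_order X R \<Longrightarrow> pattern X k \<phi> R \<in> \<Sigma>"
    using patterns_in_invariant_set[OF \<Sigma>(2,3,1)] by blast
  have \<phi>_top: "pattern X k \<phi> R \<in> topspace (Omega X k)" if "clopen_order X R" for R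
    using \<phi>[OF that] closedin_subset[OF \<Sigma>(2)] by blast
  define S where "S = {pattern X k \<phi> R | R. clopen_order X R}"
  define f where "f c = pattern X k \<phi> (chain_order c)" for c
  have order: "clopen_order X (chain_order c)" if "c \<in> topspace (Phi_space X)" for c
    using that clopen_order_chain_order by (simp add: topspace_Phi)
  have "S = \<Sigma>"
  proof (rule minimal)
    \<comment> \<open>The Hausdorff maximal principle provides a chain, hence at least one
      order.\<close>
    obtain c where "subset.maxchain (hyp X) c" using subset.Hausdorff[of "hyp X"] by blast
    then have "clopen_order X (chain_order c)" by (rule clopen_order_chain_order)
    then show "S \<noteq> {}" unfolding S_def by blast
    show "closedin (Omega X k) S" unfolding S_def by (rule closedin_patterns[OF \<phi>_top])
    show "S \<subseteq> \<Sigma>" using \<phi> by (auto simp: S_def)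
    show "invariant_set (act_Omega X k) (homeo X) S"
      unfolding invariant_set_def
    proof (intro ballI)
      fix g p assume g: "g \<in> homeo X" and "p \<in> S"
      then obtain R where R: "p = pattern X k \<phi> R" "clopen_order X R" unfolding S_def by blast
      have g': "homeomorphic_map X X g" using g by (simp add: homeo_def)
      show "act_Omega X k g p \<in> S"
        unfolding R(1) act_Omega_pattern[OF g'] S_def
        using clopen_order_image[OF R(2) homeomorphic_map_inv_into[OF g']] by blast
    qed
  qed
  have "continuous_map (Phi_space X) (Omega X k) f"
    unfolding f_def
  proof (rule continuous_map_pattern)
    show "pattern X k \<phi> (chain_order c) \<in> topspace (Omega X k)" if "c \<in> topspace (Phi_space X)" for c
      using \<phi>_top[OF order[OF that]] .
    show "clopen_pred (Phi_space X) (\<lambda>c. chain_order c A B)" if "A \<in> clopens X" "B \<in> clopens X" for A B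
      using openin_Phi_chain_order[OF that] by (simp add: clopen_pred_def)
  qed
  moreover have image: "f ` topspace (Phi_space X) = \<Sigma>"
  proof (intro equalityI subsetI)
    fix p assume "p \<in> f ` topspace (Phi_space X)"
    then obtain c where "c \<in> topspace (Phi_space X)" "p = f c" by blast
    then show "p \<in> \<Sigma>" using \<phi>[OF order] unfolding f_def by simp
  next
    fix p assume "p \<in> \<Sigma>"
    then obtain R where R: "p = pattern X k \<phi> R" "clopen_order X R"
      unfolding \<open>S = \<Sigma>\<close>[symmetric] S_def by blast
    \<comment> \<open>Every order is induced by a chain, so the patterns of chains exhaust
      \<open>S\<close>.\<close>
    have "f (order_chain X R) = p"
      unfolding f_def R(1) using chain_order_order_chain[OF R(2)] by (rule pattern_cong)
    then show "p \<in> f ` topspace (Phi_space X)" using order_chain_in_Phi[OF R(2)] by (metis imageI)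
  qed
  moreover have "f (act_Phi g c) = act_Omega X k g (f c)"
    if g: "g \<in> homeo X" and c: "c \<in> topspace (Phi_space X)" for g c
  proof -
    have g': "homeomorphic_map X X g" using g by (simp add: homeo_def)
    have "F \<subseteq> topspace X" if "F \<in> c" for F
    proof -
      have "F \<in> hyp X"
        using c that unfolding topspace_Phi subset.maxchain_def subset_chain_def by blast
      then show ?thesis using closedin_subset[of X F] by (simp add: hyp_def)
    qed
    then have "chain_order (act_Phi g c) A B
        = chain_order c (inv_into (topspace X) g ` A) (inv_into (topspace X) g ` B)"
      if "A \<in> clopens X" "B \<in> clopens X" for A B
      by (intro chain_order_act_Phi[OF g' _ clopen_subset[OF that(1)] clopen_subset[OF that(2)]])
    then show ?thesis unfolding f_def act_Omega_pattern[OF g'] by (rule pattern_cong)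
  qed
  moreover have "f \<in> topspace (Phi_space X) \<rightarrow> \<Sigma>" using image by blast
  ultimately show ?thesis by (intro exI[of _ f]) (simp add: continuous_map_in_subtopology)
qed

end

theorem theorem4p9:
  fixes X :: "'a topology" and k :: nat and \<Sigma> :: "('a set list \<Rightarrow> int) set"
  assumes "compact_space X" and "Hausdorff_space X" and "X dim_le 0"
    and "infinite (topspace X)" and "h_homogeneous X"
    and "k \<ge> 1"
    and "minimal_subsystem (Omega X k) (act_Omega X k) (homeo X) \<Sigma>"
  shows "\<exists>f. continuous_map (Phi_space X) (subtopology (Omega X k) \<Sigma>) f \<and>
             f ` topspace (Phi_space X) = \<Sigma> \<and>
             (\<forall>g\<in>homeo X. \<forall>c\<in>topspace (Phi_space X). f (act_Phi g c) = act_Omega X k g (f c))"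
proof -
  interpret h_homogeneous_compactum X
    using assms(1-5) by unfold_locales auto
  show ?thesis using assms(7) by (rule minimal_subsystem_factor)
qed

end
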